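(* There exists an $O(n^4)$-time TSP-domination algorithm which has domination ratio at least $1-6n^{-2\varepsilon}$ for every $(n,d,r,\varepsilon)$-dense instance $(n,w)$ of TSP.
   Context: $K_n=(V_n,E_n)$ is the complete graph on $n$ vertices, $\mathcal H_n$ its set of (undirected) Hamilton cycles; $w(G)=\sum_{e\in E(G)}w(e)$; a $\{0,1\}$-instance has $w:E_n\to\{0,1\}$. An optimal matching of $K_n$ is any set of $\lfloor n/2\rfloor$ pairwise disjoint edges. A TSP-domination algorithm, given $(n,w)$, outputs a Hamilton cycle $H^*$; it has domination ratio at least $\rho$ for $(n,w)$ if $\mathbb{P}(w(H)<w(H^* ))\le1-\rho$ for $H$ uniform in $\mathcal H_n$. For an integer $n\ge4$, $r>0$, $d\in[0,1]$, $\varepsilon\in(0,1/2)$, a $\{0,1\}$-instance $(n,w)$ is $(n,d,r,\varepsilon)$-dense if (i) $w(K_n)=d\binom n2$ with $1-d\le1/12$; (ii) $w(M)\ge\frac12dn-r$ for every optimal matching $M$ of $K_n$; (iii) $6\bar d^2(n+1)+46r+3\bar d\le n^{1/2-\varepsilon}$, where $\bar d:=1-d$. *)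

theory Defs
  imports Main "HOL-Library.Discrete_Functions" Complex_Main
begin

definition edges :: "nat \<Rightarrow> nat set set" where
  "edges n = {{u, v} | u v. u < n \<and> v < n \<and> u \<noteq> v}"

definition cycle_edges :: "nat list \<Rightarrow> nat set set" where
  "cycle_edges vs = {{vs ! i, vs ! ((i + 1) mod length vs)} | i. i < length vs}"

definition is_vertex_order :: "nat \<Rightarrow> nat list \<Rightarrow> bool" where
  "is_vertex_order n vs \<longleftrightarrow> distinct vs \<and> set vs = {0..<n}"

definition ham_cycles :: "nat \<Rightarrow> nat set set set" where
  "ham_cycles n = {cycle_edges vs | vs. is_vertex_order n vs}"

definition weight :: "(nat set \<Rightarrow> real) \<Rightarrow> nat set set \<Rightarrow> real" where
  "weight w G = (\<Sum>e\<in>G. w e)"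

definition zero_one_instance :: "nat \<Rightarrow> (nat set \<Rightarrow> real) \<Rightarrow> bool" where
  "zero_one_instance n w \<longleftrightarrow> (\<forall>e\<in>edges n. w e = 0 \<or> w e = 1)"

definition optimal_matching :: "nat \<Rightarrow> nat set set \<Rightarrow> bool" where
  "optimal_matching n M \<longleftrightarrow> M \<subseteq> edges n \<and> card M = n div 2 \<and>
     (\<forall>e\<in>M. \<forall>f\<in>M. e \<noteq> f \<longrightarrow> e \<inter> f = {})"

definition dense_instance ::
  "nat \<Rightarrow> real \<Rightarrow> real \<Rightarrow> real \<Rightarrow> (nat set \<Rightarrow> real) \<Rightarrow> bool" where
  "dense_instance n d r \<epsilon> w \<longleftrightarrow>
     n \<ge> 4 \<and> r > 0 \<and> 0 \<le> d \<and> d \<le> 1 \<and> 0 < \<epsilon> \<and> \<epsilon> < 1/2 \<and>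
     zero_one_instance n w \<and>
     weight w (edges n) = d * real (n choose 2) \<and> 1 - d \<le> 1/12 \<and>
     (\<forall>M. optimal_matching n M \<longrightarrow> weight w M \<ge> d * real n / 2 - r) \<and>
     6 * (1 - d)^2 * (real n + 1) + 46 * r + 3 * (1 - d) \<le> real n powr (1/2 - \<epsilon>)"

text \<open>Domination ratio at least rho: P(w(H) < w(H*)) \<le> 1 - rho for H uniform
  in the set of Hamilton cycles (probability written as a ratio of cardinalities).\<close>
definition domination_ratio_at_least ::
  "nat \<Rightarrow> (nat set \<Rightarrow> real) \<Rightarrow> nat set set \<Rightarrow> real \<Rightarrow> bool" where
  "domination_ratio_at_least n w Hs \<rho> \<longleftrightarrow>
     real (card {H \<in> ham_cycles n. weight w H < weight w Hs})
       \<le> (1 - \<rho>) * real (card (ham_cycles n))"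

section \<open>Unit-cost random access machine (additions/subtractions only)\<close>

datatype instr =
    LoadConst nat nat
  | Add nat nat nat
  | Sub nat nat nat
  | LoadInd nat nat
  | StoreInd nat nat
  | Jz nat nat

type_synonym config = "nat \<times> (nat \<Rightarrow> nat)"

fun exec_instr :: "instr \<Rightarrow> config \<Rightarrow> config" where
  "exec_instr (LoadConst i c) (pc, m) = (pc + 1, m(i := c))"
| "exec_instr (Add i j k) (pc, m) = (pc + 1, m(i := m j + m k))"
| "exec_instr (Sub i j k) (pc, m) = (pc + 1, m(i := m j - m k))"
| "exec_instr (LoadInd i j) (pc, m) = (pc + 1, m(i := m (m j)))"
| "exec_instr (StoreInd i j) (pc, m) = (pc + 1, m(m i := m j))"
| "exec_instr (Jz i l) (pc, m) = (if m i = 0 then l else pc + 1, m)"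

definition halted :: "instr list \<Rightarrow> config \<Rightarrow> bool" where
  "halted P c \<longleftrightarrow> fst c \<ge> length P"

definition step :: "instr list \<Rightarrow> config \<Rightarrow> config" where
  "step P c = (if halted P c then c else exec_instr (P ! fst c) c)"

definition run :: "instr list \<Rightarrow> nat \<Rightarrow> config \<Rightarrow> config" where
  "run P t c = (step P ^^ t) c"

text \<open>Input encoding of a {0,1}-instance (n,w): m[0] = n, m[1 + u*n + v] = w({u,v})
  for distinct u,v < n, all other cells 0; execution starts at pc 0.\<close>
definition input_mem :: "nat \<Rightarrow> (nat set \<Rightarrow> real) \<Rightarrow> nat \<Rightarrow> nat" where
  "input_mem n w a =
     (if a = 0 then n
      else if a - 1 < n * n \<and> (a - 1) div n \<noteq> (a - 1) mod n
              \<and> w {(a - 1) div n, (a - 1) mod n} = 1 then 1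
      else 0)"

definition output_list :: "nat \<Rightarrow> config \<Rightarrow> nat list" where
  "output_list n c = map (\<lambda>i. snd c (Suc i)) [0..<n]"

end

theory Submission
  imports Defs
begin

text \<open>Let \<open>G\<close> be the graph of weight-zero edges; a Hamilton cycle is light if it uses many edges of
  \<open>G\<close>. Density bounds every matching of \<open>G\<close> by \<open>(1 - d) n / 2 + r\<close>. Greedily matching the heavy
  vertices and counting edges shows that a maximum matching of \<open>G\<close> without its heavy vertices has at
  most \<open>2 r\<close> edges, so that after the additional removal of the few medium vertices only
  \<open>O(r\<^sup>2)\<close> edges of \<open>G\<close> remain. A uniform Hamilton cycle contains any given edge with
  probability \<open>2 / (n - 1)\<close>, hence meets these remaining edges with probability \<open>O(r\<^sup>2 / n)\<close>;
  otherwise it has at most two edges of \<open>G\<close> per heavy or medium vertex. The algorithm attains that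
  bound: it gives each heavy or medium vertex two private neighbours in \<open>G\<close> and concatenates the
  resulting paths of length two.

  In the input encoding, the first row of the weight matrix is redundant by symmetry, so for
  \<open>n \<ge> 23\<close> the cells 0 to 23 can serve as registers without loss of information. For smaller \<open>n\<close>
  either \<open>G\<close> has no edge or the claimed ratio is not positive, so any cycle will do.\<close>

section \<open>A loop language and its compilation to the machine\<close>

text \<open>The quarter in \<open>heavy\<close> comes from playing two counts against each other.
  Let \<open>a\<close> be the number of heavy vertices and \<open>q\<close> the size of a maximum
  matching among the rest. Greedy extension gives \<open>a + q <= (1 - d) n / 2 + r\<close>. The
  edges away from heavy vertices are covered by \<open>2 q\<close> vertices of degree at most
  \<open>(n - 1) / 4\<close>, so twice the number of edges of \<open>G\<close>, which is
  \<open>(1 - d) n (n - 1)\<close>, is at most \<open>(2 a + q) (n - 1)\<close>. Here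
  \<open>q\<close> has coefficient 1, while doubling the first bound gives it coefficient 2; the
  difference yields \<open>q <= 2 r\<close>. Removing only the heavy vertices would not suffice:
  edges of order \<open>r n\<close> could remain, and a random cycle may well meet one. Removing the
  medium vertices too lowers the remaining degrees to \<open>3 q + 1\<close>, so the meeting
  probability is of order \<open>r^2 / n\<close>, which condition (iii) bounds by a multiple of
  \<open>n^(-2 eps)\<close>. The algorithm knows neither \<open>r\<close> nor \<open>q\<close>. It
  classifies vertices by degrees alone; matchings occur only in the analysis.\<close>

type_synonym store = "(nat \<Rightarrow> nat) \<times> (nat \<Rightarrow> nat \<Rightarrow> nat)"

text \<open>Every loop makes exactly \<open>n\<close> passes and there is no other iteration, so
  running time is bounded by a function of the program text and \<open>n\<close>, and no termination
  argument is ever needed.\<close>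

datatype com =
    Const nat nat
  | Num nat
  | Plus nat nat nat
  | Minus nat nat nat
  | Get nat nat nat
  | Put nat nat nat
  | Peek nat nat
  | Seq com com  (infixr ";;" 60)
  | Cond nat com com
  | For nat com

definition set_reg :: "nat \<Rightarrow> nat \<Rightarrow> store \<Rightarrow> store" where
  "set_reg r x s = ((fst s)(r := x), snd s)"

text \<open>A loop leaves \<open>n\<close> in its register because the compiled loop exits with that
  value in its cell.\<close>

fun sem :: "(nat \<Rightarrow> nat) \<Rightarrow> nat \<Rightarrow> com \<Rightarrow> store \<Rightarrow> store" where
  "sem w n (Const r c) s = set_reg r c s"
| "sem w n (Num r) s = set_reg r n s"
| "sem w n (Plus r a b) s = set_reg r (fst s a + fst s b) s"
| "sem w n (Minus r a b) s = set_reg r (fst s a - fst s b) s"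
| "sem w n (Get r k i) s = set_reg r (snd s k (fst s i)) s"
| "sem w n (Put k i r) s = (fst s, (snd s)(k := (snd s k)(fst s i := fst s r)))"
| "sem w n (Peek r p) s = set_reg r (w (fst s p)) s"
| "sem w n (c ;; c') s = sem w n c' (sem w n c s)"
| "sem w n (Cond r c c') s = (if fst s r \<noteq> 0 then sem w n c s else sem w n c' s)"
| "sem w n (For r c) s = set_reg r n (fold (\<lambda>i s. sem w n c (set_reg r i s)) [0..<n] s)"

fun writes :: "com \<Rightarrow> nat set" where
  "writes (Const r c) = {r}"
| "writes (Num r) = {r}"
| "writes (Plus r a b) = {r}"
| "writes (Minus r a b) = {r}"
| "writes (Get r k i) = {r}"
| "writes (Put k i r) = {}"
| "writes (Peek r p) = {r}"
| "writes (c ;; c') = writes c \<union> writes c'"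
| "writes (Cond r c c') = writes c \<union> writes c'"
| "writes (For r c) = insert r (writes c)"

fun wf_com :: "com \<Rightarrow> bool" where
  "wf_com (Const r c) \<longleftrightarrow> r < 16"
| "wf_com (Num r) \<longleftrightarrow> r < 16"
| "wf_com (Plus r a b) \<longleftrightarrow> r < 16 \<and> a < 16 \<and> b < 16"
| "wf_com (Minus r a b) \<longleftrightarrow> r < 16 \<and> a < 16 \<and> b < 16"
| "wf_com (Get r k i) \<longleftrightarrow> r < 16 \<and> k < 8 \<and> i < 16"
| "wf_com (Put k i r) \<longleftrightarrow> r < 16 \<and> k < 8 \<and> i < 16"
| "wf_com (Peek r p) \<longleftrightarrow> r < 16 \<and> p < 16"
| "wf_com (c ;; c') \<longleftrightarrow> wf_com c \<and> wf_com c'"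
| "wf_com (Cond r c c') \<longleftrightarrow> r < 16 \<and> wf_com c \<and> wf_com c'"
| "wf_com (For r c) \<longleftrightarrow> r < 16 \<and> wf_com c \<and> r \<notin> writes c"

text \<open>An upper bound, since \<open>Cond\<close> is charged for both branches. A loop pays 1 to
  initialise, 4 per pass for test, increment and jump back, and 2 for the final test.\<close>

fun cost :: "nat \<Rightarrow> com \<Rightarrow> nat" where
  "cost n (Get r k i) = 7"
| "cost n (Put k i r) = 7"
| "cost n (Peek r p) = 8"
| "cost n (c ;; c') = cost n c + cost n c'"
| "cost n (Cond r c c') = 2 + cost n c + cost n c'"
| "cost n (For r c) = 3 + n * (4 + cost n c)"
| "cost n c = 1"

fun code_len :: "com \<Rightarrow> nat" where
  "code_len (Get r k i) = 7"
| "code_len (Put k i r) = 7"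
| "code_len (Peek r p) = 8"
| "code_len (c ;; c') = code_len c + code_len c'"
| "code_len (Cond r c c') = 2 + code_len c + code_len c'"
| "code_len (For r c) = 5 + code_len c"
| "code_len c = 1"

text \<open>Cells 0 to 3 hold \<open>n\<close>, 1, the base of the arrays and 0; cells 4 to 7 are scratch; cell
  \<open>r + 8\<close> is register \<open>r\<close>; entry \<open>i\<close> of array \<open>k\<close> is stored at \<open>base + 8 * i + k\<close>, so that no
  array access can hit another array or the input.\<close>

definition addr_code :: "nat \<Rightarrow> nat \<Rightarrow> instr list" where
  "addr_code k i = [Add 4 (i + 8) (i + 8), Add 4 4 4, Add 4 4 4, Add 4 4 2, LoadConst 5 k, Add 4 4 5]"

text \<open>Jump targets are absolute, hence the position argument. Cell 3 is always 0, so
  \<open>Jz 3\<close> is an unconditional jump and adding cell 3 is a copy. \<open>Peek\<close>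
  guards its load by truncated subtraction: cell 5 is 0 iff the address is below 24, cell 6 iff it
  is at or beyond the base.\<close>

fun comp :: "com \<Rightarrow> nat \<Rightarrow> instr list" where
  "comp (Const r c) p = [LoadConst (r + 8) c]"
| "comp (Num r) p = [Add (r + 8) 0 3]"
| "comp (Plus r a b) p = [Add (r + 8) (a + 8) (b + 8)]"
| "comp (Minus r a b) p = [Sub (r + 8) (a + 8) (b + 8)]"
| "comp (Get r k i) p = addr_code k i @ [LoadInd (r + 8) 4]"
| "comp (Put k i r) p = addr_code k i @ [StoreInd 4 (r + 8)]"
| "comp (Peek r q) p = [Add 4 (q + 8) 3, LoadConst 5 23, Sub 5 4 5, Sub 6 2 4, LoadConst (r + 8) 0,
     Jz 5 (p + 8), Jz 6 (p + 8), LoadInd (r + 8) 4]"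
| "comp (c ;; c') p = comp c p @ comp c' (p + code_len c)"
| "comp (Cond r c c') p = [Jz (r + 8) (p + 2 + code_len c)] @ comp c (p + 1) @
     [Jz 3 (p + 2 + code_len c + code_len c')] @ comp c' (p + 2 + code_len c)"
| "comp (For r c) p = [LoadConst (r + 8) 0, Sub 4 0 (r + 8), Jz 4 (p + 5 + code_len c)] @
     comp c (p + 3) @ [Add (r + 8) (r + 8) 1, Jz 3 (p + 1)]"

lemma length_comp [simp]: "length (comp c p) = code_len c"
  by (induction c arbitrary: p) (auto simp: addr_code_def)

section \<open>Bounded execution of code fragments and correctness of the compiler\<close>

definition code_at :: "instr list \<Rightarrow> nat \<Rightarrow> instr list \<Rightarrow> bool" where
  "code_at P p c \<longleftrightarrow> (\<exists>xs ys. P = xs @ c @ ys \<and> length xs = p)"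

lemma code_at_append:
  "code_at P p (c @ c') \<longleftrightarrow> code_at P p c \<and> code_at P (p + length c) c'"
proof
  assume "code_at P p (c @ c')"
  then obtain xs ys where "P = xs @ (c @ c') @ ys" "length xs = p"
    by (auto simp: code_at_def)
  then show "code_at P p c \<and> code_at P (p + length c) c'"
    unfolding code_at_def by (metis append.assoc length_append)
next
  assume "code_at P p c \<and> code_at P (p + length c) c'"
  then obtain xs ys xs' ys' where "P = xs @ c @ ys" "length xs = p"
    "P = xs' @ c' @ ys'" "length xs' = p + length c"
    unfolding code_at_def by blast
  then have "xs' = xs @ c" "ys = c' @ ys'"
    by (metis append_eq_append_conv append.assoc length_append)+
  with \<open>P = xs @ c @ ys\<close> \<open>length xs = p\<close> show "code_at P p (c @ c')"
    by (auto simp: code_at_def)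
qed

lemma code_at_Cons:
  "code_at P p (i # c) \<longleftrightarrow> (p < length P \<and> P ! p = i) \<and> code_at P (Suc p) c"
proof -
  have "code_at P p [i] \<longleftrightarrow> p < length P \<and> P ! p = i"
    unfolding code_at_def by (auto simp: nth_append) (metis id_take_nth_drop length_take min.absorb4)
  then show ?thesis
    using code_at_append[of P p "[i]" c] by simp
qed

lemma run_add: "run P (s + t) c = run P t (run P s c)"
  unfolding run_def by (metis add.commute comp_apply funpow_add)

lemma run_0 [simp]: "run P 0 c = c"
  by (simp add: run_def)

lemma run_Suc:
  "p < length P \<Longrightarrow> run P (Suc t) (p, m) = run P t (exec_instr (P ! p) (p, m))"
  unfolding run_def funpow_Suc_right by (simp add: step_def halted_def)

definition reaches :: "instr list \<Rightarrow> nat \<Rightarrow> config \<Rightarrow> config \<Rightarrow> bool" where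
  "reaches P b c c' \<longleftrightarrow> (\<exists>t\<le>b. run P t c = c')"

lemma reaches_refl: "reaches P b c c"
  unfolding reaches_def by (intro exI[of _ 0]) simp

lemma reaches_trans:
  assumes "reaches P a c c'" "reaches P b c' c''" "a + b \<le> d"
  shows "reaches P d c c''"
proof -
  obtain s t where "s \<le> a" "run P s c = c'" "t \<le> b" "run P t c' = c''"
    using assms unfolding reaches_def by blast
  with assms(3) show ?thesis
    unfolding reaches_def by (intro exI[of _ "s + t"]) (simp add: run_add)
qed

lemma reaches_run: "run P t c = c' \<Longrightarrow> t \<le> b \<Longrightarrow> reaches P b c c'"
  unfolding reaches_def by blast

lemmas run_simps = code_at_Cons run_Suc numeral_nat(1) eval_nat_numeral

text \<open>The input is only claimed to survive from cell 24 up to the base \<open>b\<close>: the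
  cells below hold constants, scratch values and registers. The scratch cells 4 to 7 are left
  unconstrained.\<close>

definition represents :: "nat \<Rightarrow> nat \<Rightarrow> (nat \<Rightarrow> nat) \<Rightarrow> (nat \<Rightarrow> nat) \<Rightarrow> store \<Rightarrow> bool" where
  "represents n b w m s \<longleftrightarrow> m 0 = n \<and> m 1 = 1 \<and> m 2 = b \<and> m 3 = 0 \<and>
     (\<forall>r<16. m (r + 8) = fst s r) \<and>
     (\<forall>a. 24 \<le> a \<and> a < b \<longrightarrow> m a = w a) \<and>
     (\<forall>k<8. \<forall>i. m (b + 8 * i + k) = snd s k i)"

text \<open>The value that \<open>Peek\<close> returns. Out-of-range addresses read as 0, so the
  semantics of a command never depends on how registers and arrays are laid out in memory.\<close>

definition clamp :: "nat \<Rightarrow> (nat \<Rightarrow> nat) \<Rightarrow> nat \<Rightarrow> nat" where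
  "clamp b w a = (if 24 \<le> a \<and> a < b then w a else 0)"

lemma represents_scratch:
  "represents n b w m s \<Longrightarrow> 24 \<le> b \<Longrightarrow> a \<in> {4..<8} \<Longrightarrow> represents n b w (m(a := x)) s"
  unfolding represents_def by auto

lemma represents_set_reg:
  "represents n b w m s \<Longrightarrow> 24 \<le> b \<Longrightarrow> r < 16 \<Longrightarrow>
    represents n b w (m(r + 8 := x)) (set_reg r x s)"
  unfolding represents_def set_reg_def by auto

text \<open>Array numbers are below 8, so division by 8 recovers index and array from an address
  beyond the base; a write therefore changes a single entry.\<close>

lemma represents_put:
  assumes "represents n b w m s" "24 \<le> b" "k < 8"
  shows "represents n b w (m(b + 8 * i + k := x)) (fst s, (snd s)(k := (snd s k)(i := x)))"
proof -
  have "b + 8 * j + l = b + 8 * i + k \<longleftrightarrow> j = i \<and> l = k" if "l < 8" for j l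
  proof
    assume "b + 8 * j + l = b + 8 * i + k"
    then have "8 * j + l = 8 * i + k" by simp
    moreover have "(8 * j + l) div 8 = j" "(8 * i + k) div 8 = i"
      using that \<open>k < 8\<close> by auto
    ultimately show "j = i \<and> l = k" by simp
  qed simp
  with assms show ?thesis
    unfolding represents_def by auto
qed

lemma sem_keeps: "r \<notin> writes c \<Longrightarrow> fst (sem w n c s) r = fst s r"
proof (induction c arbitrary: s)
  case (For q c)
  have "fst (fold (\<lambda>i s. sem w n c (set_reg q i s)) xs s) r = fst s r" for xs s
    using For by (induction xs arbitrary: s) (auto simp: set_reg_def)
  with For show ?case
    by (auto simp: set_reg_def)
qed (auto simp: set_reg_def)

lemma length_addr_code [simp]: "length (addr_code k i) = 6"
  by (simp add: addr_code_def)

lemma addr_code_run: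
  assumes "code_at P p (addr_code k i)" "represents n b w m s" "24 \<le> b" "i < 16"
  shows "\<exists>m'. run P 6 (p, m) = (p + 6, m') \<and> represents n b w m' s \<and> m' 4 = b + 8 * fst s i + k"
proof -
  have r: "m (i + 8) = fst s i" "m 2 = b"
    using assms by (auto simp: represents_def)
  define m' where "m' = m(4 := b + 8 * fst s i + k, 5 := k)"
  have "run P 6 (p, m) = (p + 6, m')"
    using assms(1) r by (simp add: addr_code_def run_simps m'_def fun_eq_iff)
  moreover have "represents n b w m' s"
    unfolding m'_def using assms by (intro represents_scratch) auto
  ultimately show ?thesis
    by (auto simp: m'_def)
qed

theorem comp_correct:
  assumes "represents n b w m s" "24 \<le> b" "wf_com c" "code_at P p (comp c p)"
  shows "\<exists>m'. reaches P (cost n c) (p, m) (p + code_len c, m') \<and>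
    represents n b w m' (sem (clamp b w) n c s)"
  using assms(1,3,4)
proof (induction c arbitrary: m s p)
  case (Const r c)
  then have "run P 1 (p, m) = (p + 1, m(r + 8 := c))"
    by (simp add: run_simps)
  with Const represents_set_reg[OF Const(1) assms(2)] show ?case
    by (auto intro: reaches_run)
next
  case (Num r)
  then have "run P 1 (p, m) = (p + 1, m(r + 8 := n))"
    by (simp add: run_simps represents_def)
  with Num represents_set_reg[OF Num(1) assms(2)] show ?case
    by (auto intro: reaches_run)
next
  case (Plus r x y)
  then have "run P 1 (p, m) = (p + 1, m(r + 8 := fst s x + fst s y))"
    by (simp add: run_simps represents_def)
  with Plus represents_set_reg[OF Plus(1) assms(2)] show ?case
    by (auto intro: reaches_run)
next
  case (Minus r x y)
  then have "run P 1 (p, m) = (p + 1, m(r + 8 := fst s x - fst s y))"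
    by (simp add: run_simps represents_def)
  with Minus represents_set_reg[OF Minus(1) assms(2)] show ?case
    by (auto intro: reaches_run)
next
  case (Get r k i)
  then have c: "code_at P p (addr_code k i)" "code_at P (p + 6) [LoadInd (r + 8) 4]"
    by (simp_all add: code_at_append)
  obtain m' where m': "run P 6 (p, m) = (p + 6, m')" "represents n b w m' s"
    "m' 4 = b + 8 * fst s i + k"
    using addr_code_run[OF c(1) Get(1) assms(2)] Get(2) by auto
  have "run P 1 (p + 6, m') = (p + 7, m'(r + 8 := snd s k (fst s i)))"
    using c(2) m' Get(2) by (simp add: run_simps represents_def)
  then have "run P (6 + 1) (p, m) = (p + 7, m'(r + 8 := snd s k (fst s i)))"
    unfolding run_add m' .
  with Get(2) represents_set_reg[OF m'(2) assms(2)] show ?case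
    by (auto intro: reaches_run)
next
  case (Put k i r)
  then have c: "code_at P p (addr_code k i)" "code_at P (p + 6) [StoreInd 4 (r + 8)]"
    by (simp_all add: code_at_append)
  obtain m' where m': "run P 6 (p, m) = (p + 6, m')" "represents n b w m' s"
    "m' 4 = b + 8 * fst s i + k"
    using addr_code_run[OF c(1) Put(1) assms(2)] Put(2) by auto
  have "run P 1 (p + 6, m') = (p + 7, m'(b + 8 * fst s i + k := fst s r))"
    using c(2) m' Put(2) by (simp add: run_simps represents_def)
  then have "run P (6 + 1) (p, m) = (p + 7, m'(b + 8 * fst s i + k := fst s r))"
    unfolding run_add m' .
  with Put(2) represents_put[OF m'(2) assms(2)] show ?case
    by (auto intro: reaches_run)
next
  case (Peek r q)
  define a where "a = fst s q"
  have r: "m (q + 8) = a" "m 2 = b" "m 3 = 0" and mw: "24 \<le> a \<Longrightarrow> a < b \<Longrightarrow> m a = w a"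
    using Peek by (auto simp: represents_def a_def)
  define m1 where "m1 = m(4 := a, 5 := a - 23, 6 := b - a)"
  define m' where "m' = m1(r + 8 := clamp b w a)"
  have c: "P ! p = Add 4 (q + 8) 3" "P ! (p + 1) = LoadConst 5 23" "P ! (p + 2) = Sub 5 4 5"
    "P ! (p + 3) = Sub 6 2 4" "P ! (p + 4) = LoadConst (r + 8) 0" "P ! (p + 5) = Jz 5 (p + 8)"
    "P ! (p + 6) = Jz 6 (p + 8)" "P ! (p + 7) = LoadInd (r + 8) 4" "p + 7 < length P"
    using Peek(3) by (auto simp: code_at_Cons eval_nat_numeral)
  have "run P 5 (p, m) = (p + 5, m1(r + 8 := 0))"
    using c r by (simp add: m1_def eval_nat_numeral run_Suc fun_eq_iff)
  then have 1: "reaches P 5 (p, m) (p + 5, m1(r + 8 := 0))"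
    by (simp add: reaches_run)
  have "\<exists>t\<le>3. run P t (p + 5, m1(r + 8 := 0)) = (p + 8, m')"
  proof (cases "a - 23 = 0 \<or> b - a = 0")
    case True
    show ?thesis
    proof (cases "a - 23 = 0")
      case True
      then have "run P 1 (p + 5, m1(r + 8 := 0)) = (p + 8, m')"
        using c by (simp add: m1_def m'_def run_Suc clamp_def)
      then show ?thesis by (intro exI[of _ 1]) simp
    next
      case False
      then have "run P 2 (p + 5, m1(r + 8 := 0)) = (p + 8, m')"
        using c True by (simp add: m1_def m'_def eval_nat_numeral run_Suc clamp_def)
      then show ?thesis by (intro exI[of _ 2]) simp
    qed
  next
    case False
    \<comment> \<open>The scratch cells and the target register have just been overwritten; as
      \<open>a\<close> is at least 24, it is none of these cells.\<close>
    then have "m1 a = w a" "a \<noteq> r + 8"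
      using mw Peek(2) by (auto simp: m1_def)
    then have "run P 3 (p + 5, m1(r + 8 := 0)) = (p + 8, m')"
      using c False by (simp add: m1_def m'_def eval_nat_numeral run_Suc clamp_def)
    then show ?thesis by (intro exI[of _ 3]) simp
  qed
  then have "reaches P 3 (p + 5, m1(r + 8 := 0)) (p + 8, m')"
    unfolding reaches_def .
  then have "reaches P 8 (p, m) (p + 8, m')"
    by (rule reaches_trans[OF 1]) simp
  moreover have "represents n b w m' (set_reg r (clamp b w a) s)"
    unfolding m'_def m1_def using Peek assms(2)
    by (intro represents_set_reg represents_scratch) auto
  ultimately show ?case
    by (auto simp: a_def)
next
  case (Seq c c')
  from Seq.prems have c: "code_at P p (comp c p)" "code_at P (p + code_len c) (comp c' (p + code_len c))"
    by (auto simp: code_at_append)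
  from Seq.IH(1)[OF Seq.prems(1) _ c(1)] Seq.prems(2) obtain m1 where
    m1: "reaches P (cost n c) (p, m) (p + code_len c, m1)" "represents n b w m1 (sem (clamp b w) n c s)"
    by auto
  from Seq.IH(2)[OF m1(2) _ c(2)] Seq.prems(2) obtain m2 where
    m2: "reaches P (cost n c') (p + code_len c, m1) (p + code_len c + code_len c', m2)"
    "represents n b w m2 (sem (clamp b w) n c' (sem (clamp b w) n c s))"
    by auto
  show ?case
    using reaches_trans[OF m1(1) m2(1), of "cost n (c ;; c')"] m2(2) by (auto simp: add.assoc)
next
  case (Cond r c c')
  have c: "p < length P" "P ! p = Jz (r + 8) (p + 2 + code_len c)" "code_at P (p + 1) (comp c (p + 1))"
    "p + 1 + code_len c < length P"
    "P ! (p + 1 + code_len c) = Jz 3 (p + 2 + code_len c + code_len c')"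
    "code_at P (p + 2 + code_len c) (comp c' (p + 2 + code_len c))"
    using Cond.prems(3) by (auto simp: code_at_append code_at_Cons)
  have wf: "wf_com c" "wf_com c'" and r: "m (r + 8) = fst s r"
    using Cond.prems by (auto simp: represents_def)
  show ?case
  proof (cases "fst s r = 0")
    case True
    then have 1: "reaches P 1 (p, m) (p + 2 + code_len c, m)"
      using c(1,2) r by (intro reaches_run[of _ 1]) (auto simp: run_Suc)
    from Cond.IH(2)[OF Cond.prems(1) wf(2) c(6)] obtain m' where
      m': "reaches P (cost n c') (p + 2 + code_len c, m) (p + 2 + code_len c + code_len c', m')"
      "represents n b w m' (sem (clamp b w) n c' s)"
      by auto
    show ?thesis
      using reaches_trans[OF 1 m'(1), of "cost n (Cond r c c')"] m'(2) True by (auto simp: add.assoc)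
  next
    case False
    then have 1: "reaches P 1 (p, m) (p + 1, m)"
      using c(1,2) r by (intro reaches_run[of _ 1]) (auto simp: run_Suc)
    from Cond.IH(1)[OF Cond.prems(1) wf(1) c(3)] obtain m' where
      m': "reaches P (cost n c) (p + 1, m) (p + 1 + code_len c, m')"
      "represents n b w m' (sem (clamp b w) n c s)"
      by auto
    have 2: "reaches P 1 (p + 1 + code_len c, m') (p + 2 + code_len c + code_len c', m')"
      using c(4,5) m'(2) by (intro reaches_run[of _ 1]) (auto simp: run_Suc represents_def)
    have "reaches P (cost n (Cond r c c')) (p, m) (p + 2 + code_len c + code_len c', m')"
      by (rule reaches_trans[OF 1 reaches_trans[OF m'(1) 2 order_refl]]) simp
    with m'(2) False show ?thesis
      by (auto simp: add.assoc)
  qed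
next
  case (For r c)
  let ?S = "sem (clamp b w) n c"
  let ?e = "p + 5 + code_len c"
  have c: "p < length P" "P ! p = LoadConst (r + 8) 0" "P ! (p + 1) = Sub 4 0 (r + 8)"
    "P ! (p + 2) = Jz 4 ?e" "code_at P (p + 3) (comp c (p + 3))"
    "P ! (p + 3 + code_len c) = Add (r + 8) (r + 8) 1"
    "P ! (p + 4 + code_len c) = Jz 3 (p + 1)" "p + 4 + code_len c < length P"
    using For.prems(3) by (auto simp: code_at_append code_at_Cons eval_nat_numeral)
  have wf: "r < 16" "wf_com c" "r \<notin> writes c"
    using For.prems by auto
  \<comment> \<open>Generalised to an entry at the loop test with the register holding
    \<open>i\<close> and \<open>j\<close> passes still to go, for induction on
    \<open>j\<close>.\<close>
  have loop: "\<exists>m'. reaches P (2 + j * (4 + cost n c)) (p + 1, m) (?e, m') \<and>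
      represents n b w m' (set_reg r n (fold (\<lambda>i s. ?S (set_reg r i s)) [i..<n] s))"
    if "represents n b w m (set_reg r i s)" "i + j = n" for i j m s
    using that
  proof (induction j arbitrary: i m s)
    case 0
    have m: "m 0 = n" "m (r + 8) = n"
      using 0 wf by (auto simp: represents_def set_reg_def)
    have "run P 2 (p + 1, m) = (?e, m(4 := 0))"
      using c m by (simp add: eval_nat_numeral run_Suc)
    then have "reaches P 2 (p + 1, m) (?e, m(4 := 0))"
      by (simp add: reaches_run)
    moreover have "represents n b w (m(4 := 0)) (set_reg r n s)"
      using 0 assms(2) by (auto intro: represents_scratch)
    ultimately show ?case
      using 0 by auto
  next
    case (Suc j)
    have m: "m 0 = n" "m (r + 8) = i"
      using Suc.prems wf by (auto simp: represents_def set_reg_def)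
    have "run P 2 (p + 1, m) = (p + 3, m(4 := n - i))"
      using c m Suc.prems by (simp add: eval_nat_numeral run_Suc)
    then have 1: "reaches P 2 (p + 1, m) (p + 3, m(4 := n - i))"
      by (simp add: reaches_run)
    have "represents n b w (m(4 := n - i)) (set_reg r i s)"
      using Suc.prems assms(2) by (auto intro: represents_scratch)
    from For.IH[OF this wf(2) c(5)] obtain m1 where
      m1: "reaches P (cost n c) (p + 3, m(4 := n - i)) (p + 3 + code_len c, m1)"
      "represents n b w m1 (?S (set_reg r i s))"
      by blast
    \<comment> \<open>The body does not write the loop register, so the increment that follows
      really produces \<open>Suc i\<close>.\<close>
    have "m1 (r + 8) = i" "m1 1 = 1" "m1 3 = 0"
      using m1(2) wf sem_keeps[OF wf(3)] by (auto simp: represents_def set_reg_def)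
    then have "run P 2 (p + 3 + code_len c, m1) = (p + 1, m1(r + 8 := Suc i))"
      using c by (simp add: eval_nat_numeral run_Suc)
    then have 2: "reaches P 2 (p + 3 + code_len c, m1) (p + 1, m1(r + 8 := Suc i))"
      by (simp add: reaches_run)
    have "represents n b w (m1(r + 8 := Suc i)) (set_reg r (Suc i) (?S (set_reg r i s)))"
      using m1(2) assms(2) wf by (auto intro: represents_set_reg)
    moreover have "Suc i + j = n"
      using Suc.prems by simp
    ultimately obtain m2 where
      m2: "reaches P (2 + j * (4 + cost n c)) (p + 1, m1(r + 8 := Suc i)) (?e, m2)"
      "represents n b w m2 (set_reg r n (fold (\<lambda>i s. ?S (set_reg r i s)) [Suc i..<n] (?S (set_reg r i s))))"
      using Suc.IH by blast
    have "reaches P (2 + Suc j * (4 + cost n c)) (p + 1, m) (?e, m2)"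
      by (rule reaches_trans[OF 1 reaches_trans[OF m1(1) reaches_trans[OF 2 m2(1) order_refl] order_refl]])
        simp
    moreover have "[i..<n] = i # [Suc i..<n]"
      using Suc.prems by (simp add: upt_conv_Cons)
    ultimately show ?case
      using m2(2) by auto
  qed
  have 0: "reaches P 1 (p, m) (p + 1, m(r + 8 := 0))"
    using c by (intro reaches_run[of _ 1]) (auto simp: run_Suc)
  have "represents n b w (m(r + 8 := 0)) (set_reg r 0 s)"
    using For.prems assms(2) wf by (auto intro: represents_set_reg)
  from loop[OF this, of n] obtain m' where
    m': "reaches P (2 + n * (4 + cost n c)) (p + 1, m(r + 8 := 0)) (?e, m')"
    "represents n b w m' (set_reg r n (fold (\<lambda>i s. ?S (set_reg r i s)) [0..<n] s))"
    by auto
  show ?case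
    using reaches_trans[OF 0 m'(1), of "cost n (For r c)"] m'(2) by (auto simp: add.assoc)
qed

section \<open>Entry code, exit code and the assembled program\<close>

definition prelude :: "instr list" where
  "prelude = [LoadConst 1 1, LoadConst 3 0, LoadConst 2 24, Add 4 0 3,
     Jz 4 8, Add 2 2 0, Sub 4 4 1, Jz 3 4]"

text \<open>Cell 5 is the target, cell 4 the source address, cell 7 the stride 8. Cell 0 holds
  \<open>n + 1\<close>, so the difference in cell 6 vanishes once the target exceeds
  \<open>n\<close>.\<close>

definition copy_loop :: "nat \<Rightarrow> instr list" where
  "copy_loop p = [Sub 6 0 5, Jz 6 (p + 7), LoadInd 6 4, StoreInd 5 6, Add 5 5 1, Add 4 4 7, Jz 3 p]"

text \<open>Targets are fixed cells in descending order; cell 0 is the source pointer and cell 1 its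
  stride. At the end the pointer stands at entry 0, whose target, cell 1, is the only one
  left.\<close>

definition copy_low :: "nat \<Rightarrow> instr list" where
  "copy_low q = concat (map (\<lambda>j. [LoadInd (j + 2) 0, Sub 0 0 1]) (rev [0..<q]))"

text \<open>The output replaces the registers themselves: cells from 24 on are written by a loop, the
  cells below by straight-line code that only needs cells 0 and 1 until the very end.\<close>

definition postlude :: "nat \<Rightarrow> instr list" where
  "postlude p = [LoadConst 7 8, LoadConst 5 24, LoadConst 4 189, Add 4 4 2, Add 0 0 1] @
     copy_loop (p + 5) @ [LoadConst 0 181, Add 0 0 2, LoadConst 1 8] @ copy_low 22 @ [LoadInd 1 0]"

definition program :: "com \<Rightarrow> instr list" where
  "program c = prelude @ comp c 8 @ postlude (8 + code_len c)"

text \<open>The machine cannot multiply; the base \<open>n * n + 24\<close> is obtained by adding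
  \<open>n\<close> to cell 2 \<open>n\<close> times, at four steps per pass.\<close>

lemma prelude_loop:
  assumes "code_at P 0 prelude" "m 0 = n" "m 1 = 1" "m 3 = 0" "m 4 = j"
  shows "reaches P (4 * j + 1) (4, m) (8, m(2 := m 2 + j * n, 4 := 0))"
  using assms(2-)
proof (induction j arbitrary: m)
  case 0
  then have "m = m(2 := m 2, 4 := 0)" by auto
  then have "run P 1 (4, m) = (8, m(2 := m 2 + 0 * n, 4 := 0))"
    using assms(1) 0 by (simp add: prelude_def code_at_Cons run_Suc eval_nat_numeral)
  then show ?case by (intro reaches_run[of _ 1]) auto
next
  case (Suc j)
  let ?m = "m(2 := m 2 + n, 4 := j)"
  have "run P 4 (4, m) = (4, ?m)"
    using assms(1) Suc.prems by (simp add: prelude_def code_at_Cons run_Suc eval_nat_numeral)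
  then have 1: "reaches P 4 (4, m) (4, ?m)" by (simp add: reaches_run)
  have "reaches P (4 * j + 1) (4, ?m) (8, ?m(2 := ?m 2 + j * n, 4 := 0))"
    by (rule Suc.IH) (use Suc.prems in auto)
  also have "?m(2 := ?m 2 + j * n, 4 := 0) = m(2 := m 2 + Suc j * n, 4 := 0)"
    by (auto simp: fun_eq_iff)
  finally show ?case
    by (rule reaches_trans[OF 1]) simp
qed

text \<open>Registers start with whatever part of the input lies in cells 8 to 23, hence the
  unspecified \<open>f\<close>. Arrays start empty because the input encoding is 0 from the base
  on.\<close>

lemma prelude_correct:
  assumes "code_at P 0 prelude"
  shows "\<exists>m f. reaches P (4 * n + 5) (0, input_mem n w) (8, m) \<and>
    represents n (n * n + 24) (input_mem n w) m (f, \<lambda>k i. 0)"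
proof -
  let ?i = "input_mem n w"
  let ?m = "?i(1 := 1, 3 := 0, 2 := 24, 4 := n)"
  have i0: "?i 0 = n" by (simp add: input_mem_def)
  have "run P 4 (0, ?i) = (4, ?m)"
    using assms i0 by (simp add: prelude_def code_at_Cons run_Suc eval_nat_numeral)
  then have 1: "reaches P 4 (0, ?i) (4, ?m)" by (simp add: reaches_run)
  have "reaches P (4 * n + 1) (4, ?m) (8, ?m(2 := ?m 2 + n * n, 4 := 0))"
    by (rule prelude_loop[OF assms]) (auto simp: i0)
  from reaches_trans[OF 1 this] have "reaches P (4 * n + 5) (0, ?i) (8, ?m(2 := ?m 2 + n * n, 4 := 0))"
    by simp
  moreover have "represents n (n * n + 24) ?i (?m(2 := ?m 2 + n * n, 4 := 0))
      (\<lambda>r. ?i (r + 8), \<lambda>k i. 0)"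
    unfolding represents_def by (auto simp: i0) (auto simp: input_mem_def)
  ultimately show ?thesis by blast
qed

lemma copy_loop_correct:
  assumes "code_at P p (copy_loop p)" "24 \<le> b" "n < b"
    and "m 0 = n + 1" "m 1 = 1" "m 3 = 0" "m 7 = 8" "m 5 = c" "m 4 = b + 5 + 8 * (c - 1)"
    "24 \<le> c" "n + 1 - c = j"
  shows "\<exists>m'. reaches P (7 * j + 2) (p, m) (p + 7, m') \<and>
    (\<forall>a. a \<notin> {4, 5, 6} \<union> {c..n} \<longrightarrow> m' a = m a) \<and>
    (\<forall>a\<in>{c..n}. m' a = m (b + 5 + 8 * (a - 1)))"
  using assms(4-)
proof (induction j arbitrary: m c)
  case 0
  have "run P 2 (p, m) = (p + 7, m(6 := 0))"
    using assms(1) 0 by (simp add: copy_loop_def code_at_Cons run_Suc eval_nat_numeral)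
  then have "reaches P 2 (p, m) (p + 7, m(6 := 0))" by (simp add: reaches_run)
  moreover have "7 * 0 + 2 = (2 :: nat)" by simp
  moreover have "{c..n} = {}" using 0 by simp
  ultimately show ?case
    by (intro exI[of _ "m(6 := 0)"]) (metis UnCI empty_iff fun_upd_other insertCI)
next
  case (Suc j)
  let ?x = "m (b + 5 + 8 * (c - 1))"
  let ?m = "m(6 := ?x, c := ?x, 5 := c + 1, 4 := b + 5 + 8 * c)"
  have c: "c \<le> n" using Suc.prems by auto
  have "run P 7 (p, m) = (p, ?m)"
    using assms(1,2) Suc.prems
    by (simp add: copy_loop_def code_at_Cons run_Suc eval_nat_numeral) (auto simp: fun_eq_iff)
  then have 1: "reaches P 7 (p, m) (p, ?m)" by (simp add: reaches_run)
  have "\<exists>m'. reaches P (7 * j + 2) (p, ?m) (p + 7, m') \<and>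
    (\<forall>a. a \<notin> {4, 5, 6} \<union> {c + 1..n} \<longrightarrow> m' a = ?m a) \<and>
    (\<forall>a\<in>{c + 1..n}. m' a = ?m (b + 5 + 8 * (a - 1)))"
    by (rule Suc.IH) (use Suc.prems in auto)
  then obtain m' where m': "reaches P (7 * j + 2) (p, ?m) (p + 7, m')"
    "\<forall>a. a \<notin> {4, 5, 6} \<union> {c + 1..n} \<longrightarrow> m' a = ?m a"
    "\<forall>a\<in>{c + 1..n}. m' a = ?m (b + 5 + 8 * (a - 1))"
    by blast
  have "reaches P (7 * Suc j + 2) (p, m) (p + 7, m')"
    by (rule reaches_trans[OF 1 m'(1)]) simp
  moreover have "m' a = m a" if "a \<notin> {4, 5, 6} \<union> {c..n}" for a
    using m'(2) that c by auto
  moreover have "m' a = m (b + 5 + 8 * (a - 1))" if "a \<in> {c..n}" for a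
  proof (cases "a = c")
    case True
    with m'(2) Suc.prems show ?thesis by auto
  next
    case False
    with m'(3) that have "m' a = ?m (b + 5 + 8 * (a - 1))" by auto
    then show ?thesis using assms(2,3) c by auto
  qed
  ultimately show ?case by blast
qed

lemma copy_low_correct:
  assumes "code_at P p (copy_low q)" "24 \<le> b" "m 0 = b + 5 + 8 * q" "m 1 = 8" "q \<le> 22"
  shows "\<exists>m'. reaches P (2 * q) (p, m) (p + 2 * q, m') \<and> m' 0 = b + 5 \<and>
    (\<forall>a\<in>{2..<q + 2}. m' a = m (b + 5 + 8 * (a - 1))) \<and> (\<forall>a\<ge>q + 2. m' a = m a)"
  using assms
proof (induction q arbitrary: p m)
  case 0
  then show ?case by (intro exI[of _ m]) (auto simp: reaches_refl)
next
  case (Suc q)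
  have c: "code_at P p [LoadInd (q + 2) 0, Sub 0 0 1]" "code_at P (p + 2) (copy_low q)"
    using Suc.prems(1) code_at_append[of P p "[LoadInd (q + 2) 0, Sub 0 0 1]" "copy_low q"]
    by (auto simp: copy_low_def)
  let ?m = "m(q + 2 := m (b + 5 + 8 * Suc q), 0 := b + 5 + 8 * q)"
  have "run P 2 (p, m) = (p + 2, ?m)"
    using c(1) Suc.prems by (simp add: code_at_Cons run_Suc eval_nat_numeral)
  then have 1: "reaches P 2 (p, m) (p + 2, ?m)" by (simp add: reaches_run)
  have "\<exists>m'. reaches P (2 * q) (p + 2, ?m) (p + 2 + 2 * q, m') \<and> m' 0 = b + 5 \<and>
    (\<forall>a\<in>{2..<q + 2}. m' a = ?m (b + 5 + 8 * (a - 1))) \<and> (\<forall>a\<ge>q + 2. m' a = ?m a)"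
    by (rule Suc.IH[OF c(2)]) (use Suc.prems in auto)
  then obtain m' where m': "reaches P (2 * q) (p + 2, ?m) (p + 2 + 2 * q, m')" "m' 0 = b + 5"
    "\<forall>a\<in>{2..<q + 2}. m' a = ?m (b + 5 + 8 * (a - 1))" "\<forall>a\<ge>q + 2. m' a = ?m a"
    by blast
  have "reaches P (2 * Suc q) (p, m) (p + 2 * Suc q, m')"
    using reaches_trans[OF 1 m'(1), of "2 * Suc q"] by simp
  moreover have "m' a = m (b + 5 + 8 * (a - 1))" if "a \<in> {2..<Suc q + 2}" for a
  proof (cases "a = q + 2")
    case True
    with m'(4) show ?thesis by simp
  next
    case False
    with m'(3) that have "m' a = ?m (b + 5 + 8 * (a - 1))" by auto
    then show ?thesis using Suc.prems by auto
  qed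
  moreover have "m' a = m a" if "a \<ge> Suc q + 2" for a
    using m'(4) that by auto
  ultimately show ?case
    using m'(2) by blast
qed

lemma length_copy [simp]: "length (copy_loop p) = 7" "length (copy_low q) = 2 * q"
  by (simp_all add: copy_loop_def copy_low_def length_concat comp_def sum_list_triv)

text \<open>Cell \<open>a\<close> must receive entry \<open>a - 1\<close> of array 5, found at
  \<open>b + 5 + 8 * (a - 1)\<close>. This gives the offsets \<open>189 = 5 + 8 * 23\<close> for the
  first cell of the loop and \<open>181 = 5 + 8 * 22\<close> for cell 23. All targets lie below
  \<open>b\<close>, so no source is overwritten.\<close>

lemma postlude_correct:
  assumes "code_at P p (postlude p)" "represents n b w m s" "24 \<le> b" "n < b"
  shows "\<exists>m'. reaches P (7 * n + 60) (p, m) (p + length (postlude p), m') \<and>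
    (\<forall>i<n. m' (Suc i) = snd s 5 i)"
proof -
  have c: "code_at P p [LoadConst 7 8, LoadConst 5 24, LoadConst 4 189, Add 4 4 2, Add 0 0 1]"
    "code_at P (p + 5) (copy_loop (p + 5))" "code_at P (p + 12) [LoadConst 0 181, Add 0 0 2, LoadConst 1 8]"
    "code_at P (p + 15) (copy_low 22)" "code_at P (p + 59) [LoadInd 1 0]"
    using assms(1) unfolding postlude_def code_at_append by (simp_all add: eval_nat_numeral)
  have m: "m 0 = n" "m 1 = 1" "m 2 = b" "m 3 = 0" and out: "\<And>i. m (b + 5 + 8 * i) = snd s 5 i"
    using assms(2) by (auto simp: represents_def algebra_simps)
  let ?m1 = "m(7 := 8, 5 := 24, 4 := 189 + b, 0 := n + 1)"
  have "run P 5 (p, m) = (p + 5, ?m1)"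
    using c(1) m by (simp add: code_at_Cons run_Suc eval_nat_numeral)
  then have 1: "reaches P 5 (p, m) (p + 5, ?m1)" by (simp add: reaches_run)
  have "\<exists>m'. reaches P (7 * (n + 1 - 24) + 2) (p + 5, ?m1) (p + 5 + 7, m') \<and>
    (\<forall>a. a \<notin> {4, 5, 6} \<union> {24..n} \<longrightarrow> m' a = ?m1 a) \<and>
    (\<forall>a\<in>{24..n}. m' a = ?m1 (b + 5 + 8 * (a - 1)))"
    by (rule copy_loop_correct[OF c(2) assms(3,4)]) (use m in auto)
  then obtain m2 where m2: "reaches P (7 * (n + 1 - 24) + 2) (p + 5, ?m1) (p + 5 + 7, m2)"
    "\<And>a. a \<notin> {4, 5, 6} \<union> {24..n} \<Longrightarrow> m2 a = ?m1 a"
    "\<And>a. a \<in> {24..n} \<Longrightarrow> m2 a = ?m1 (b + 5 + 8 * (a - 1))"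
    by blast
  have "m2 2 = b" using m2(2)[of 2] m by simp
  define m3 where "m3 = m2(0 := b + 5 + 8 * 22, 1 := 8)"
  have "run P 3 (p + 12, m2) = (p + 15, m3)"
    using c(3) \<open>m2 2 = b\<close> by (simp add: code_at_Cons run_Suc eval_nat_numeral m3_def)
  then have 3: "reaches P 3 (p + 12, m2) (p + 15, m3)" by (simp add: reaches_run)
  obtain m4 where m4: "reaches P (2 * 22) (p + 15, m3) (p + 15 + 2 * 22, m4)" "m4 0 = b + 5"
    "\<forall>a\<in>{2..<22 + 2}. m4 a = m3 (b + 5 + 8 * (a - 1))" "\<forall>a\<ge>22 + 2. m4 a = m3 a"
    using copy_low_correct[OF c(4) assms(3), of m3] by (auto simp: m3_def)
  have "run P 1 (p + 59, m4) = (p + 60, m4(1 := m4 (b + 5)))"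
    using c(5) m4(2) by (simp add: code_at_Cons run_Suc eval_nat_numeral)
  then have 5: "reaches P 1 (p + 59, m4) (p + 60, m4(1 := m4 (b + 5)))" by (simp add: reaches_run)
  have p: "p + 5 + 7 = p + 12" "p + 15 + 2 * 22 = p + 59" by simp_all
  have "reaches P (7 * n + 60) (p, m) (p + 60, m4(1 := m4 (b + 5)))"
    by (rule reaches_trans[OF 1 reaches_trans[OF m2(1)[unfolded p(1)] reaches_trans[OF 3
          reaches_trans[OF m4(1)[unfolded p(2)] 5 order_refl] order_refl] order_refl]]) simp
  moreover have far: "m3 (b + 5 + 8 * i) = snd s 5 i" for i
    using m2(2)[of "b + 5 + 8 * i"] assms(3,4) out[of i] by (auto simp: m3_def)
  have "(m4(1 := m4 (b + 5))) (Suc i) = snd s 5 i" if "i < n" for i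
  proof -
    consider "i = 0" | "Suc i \<in> {2..<24}" | "Suc i \<in> {24..n}"
      using \<open>i < n\<close> by force
    then show ?thesis
    proof cases
      case 1
      with m4(4) far[of 0] assms(3) show ?thesis by simp
    next
      case 2
      with m4(3) far[of i] show ?thesis by force
    next
      case 3
      with m4(4) have "m4 (Suc i) = m2 (Suc i)" by (simp add: m3_def)
      also have "\<dots> = snd s 5 i" using m2(3)[OF 3] out[of i] assms(3) by simp
      finally show ?thesis using 3 by simp
    qed
  qed
  ultimately show ?thesis
    by (auto simp: postlude_def)
qed

theorem program_correct:
  assumes "wf_com c"
  shows "\<exists>t\<le>cost n c + 11 * n + 65. \<exists>f. let r = run (program c) t (0, input_mem n w) in
    halted (program c) r \<and>
    output_list n r = map (snd (sem (clamp (n * n + 24) (input_mem n w)) n c (f, \<lambda>k i. 0)) 5) [0..<n]"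
proof -
  let ?P = "program c" and ?i = "input_mem n w" and ?b = "n * n + 24"
  have "code_at ?P 0 (program c)"
    by (auto simp: code_at_def)
  moreover have "length prelude = 8"
    by (simp add: prelude_def)
  ultimately have c: "code_at ?P 0 prelude" "code_at ?P 8 (comp c 8)"
    "code_at ?P (8 + code_len c) (postlude (8 + code_len c))"
    unfolding program_def by (auto simp: code_at_append)
  obtain m f where m: "reaches ?P (4 * n + 5) (0, ?i) (8, m)" "represents n ?b ?i m (f, \<lambda>k i. 0)"
    using prelude_correct[OF c(1)] by blast
  let ?s = "sem (clamp ?b ?i) n c (f, \<lambda>k i. 0)"
  obtain m' where m': "reaches ?P (cost n c) (8, m) (8 + code_len c, m')" "represents n ?b ?i m' ?s"
    using comp_correct[OF m(2) _ assms c(2)] by auto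
  have "n < ?b" using le_square[of n] by linarith
  then obtain m'' where m'': "reaches ?P (7 * n + 60) (8 + code_len c, m')
      (8 + code_len c + length (postlude (8 + code_len c)), m'')" "\<forall>i<n. m'' (Suc i) = snd ?s 5 i"
    using postlude_correct[OF c(3) m'(2)] by auto
  have "8 + code_len c + length (postlude (8 + code_len c)) = length ?P"
    using \<open>length prelude = 8\<close> by (simp add: program_def)
  with m'' reaches_trans[OF m(1) reaches_trans[OF m'(1) m''(1) order_refl], of "cost n c + 11 * n + 65"]
  have "reaches ?P (cost n c + 11 * n + 65) (0, ?i) (length ?P, m'')"
    by simp
  then obtain t where t: "t \<le> cost n c + 11 * n + 65" "run ?P t (0, ?i) = (length ?P, m'')"
    by (auto simp: reaches_def)
  with m''(2) show ?thesis
    by (intro exI[of _ t] conjI exI[of _ f]) (auto simp: halted_def output_list_def Let_def)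
qed

section \<open>Heavy and medium vertices\<close>

text \<open>\<open>E\<close> is the adjacency relation of the graph of weight-zero edges. Heavy vertices have degree of
  order \<open>n\<close>; after their removal, a vertex is medium if its degree is at least three times (up to
  one) the number of vertices of no smaller degree. This self-referential threshold makes it possible
  to give every medium vertex two private neighbours without knowing \<open>r\<close>.\<close>

definition heavy :: "(nat \<Rightarrow> nat \<Rightarrow> bool) \<Rightarrow> nat \<Rightarrow> nat \<Rightarrow> bool" where
  "heavy E n v \<longleftrightarrow> n \<le> 4 * (card {u. u < n \<and> E v u} + 1)"

definition light_degree :: "(nat \<Rightarrow> nat \<Rightarrow> bool) \<Rightarrow> nat \<Rightarrow> nat \<Rightarrow> nat" where
  "light_degree E n v = card {u. u < n \<and> \<not> heavy E n u \<and> E v u}"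

definition degree_rank :: "(nat \<Rightarrow> nat \<Rightarrow> bool) \<Rightarrow> nat \<Rightarrow> nat \<Rightarrow> nat" where
  "degree_rank E n v = card {u. u < n \<and> \<not> heavy E n u \<and> light_degree E n v \<le> light_degree E n u}"

definition medium :: "(nat \<Rightarrow> nat \<Rightarrow> bool) \<Rightarrow> nat \<Rightarrow> nat \<Rightarrow> bool" where
  "medium E n v \<longleftrightarrow> \<not> heavy E n v \<and> 3 * degree_rank E n v \<le> light_degree E n v + 1"

text \<open>Private neighbours are drawn from this set only, so that no heavy or medium vertex is
  used up as a neighbour before its own turn.\<close>

definition small_nbrs :: "(nat \<Rightarrow> nat \<Rightarrow> bool) \<Rightarrow> nat \<Rightarrow> nat \<Rightarrow> nat set" where
  "small_nbrs E n v = {u. u < n \<and> \<not> heavy E n u \<and> \<not> medium E n u \<and> E v u}"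

section \<open>The algorithm as a program\<close>

fun puts :: "com \<Rightarrow> nat set" where
  "puts (Put k i r) = {k}"
| "puts (c ;; c') = puts c \<union> puts c'"
| "puts (Cond r c c') = puts c \<union> puts c'"
| "puts (For r c) = puts c"
| "puts c = {}"

lemma sem_keeps_array: "k \<notin> puts c \<Longrightarrow> snd (sem w n c s) k = snd s k"
proof (induction c arbitrary: s)
  case (For q c)
  have "snd (fold (\<lambda>i s. sem w n c (set_reg q i s)) xs s) k = snd s k" for xs s
    using For by (induction xs arbitrary: s) (auto simp: set_reg_def)
  with For show ?case
    by (auto simp: set_reg_def)
qed (auto simp: set_reg_def)

lemma sem_For_invariant:
  assumes "Inv 0 s"
    and "\<And>i s. i < n \<Longrightarrow> Inv i s \<Longrightarrow> Inv (Suc i) (sem w n c (set_reg r i s))"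
  shows "\<exists>s'. Inv n s' \<and> sem w n (For r c) s = set_reg r n s'"
proof -
  have "Inv j (fold (\<lambda>i s. sem w n c (set_reg r i s)) [0..<j] s)" if "j \<le> n" for j
    using that by (induction j) (auto simp: assms)
  then show ?thesis unfolding sem.simps by blast
qed

text \<open>The larger endpoint is taken as the row, so row 0 is never read. The value 1 on the
  diagonal makes \<open>adj\<close> irreflexive.\<close>

definition edge_val :: "(nat \<Rightarrow> nat) \<Rightarrow> nat \<Rightarrow> nat \<Rightarrow> nat \<Rightarrow> nat" where
  "edge_val w n u v = (if u = v then 1 else w (1 + max u v * n + min u v))"

definition adj :: "(nat \<Rightarrow> nat) \<Rightarrow> nat \<Rightarrow> nat \<Rightarrow> nat \<Rightarrow> bool" where
  "adj w n u v \<longleftrightarrow> edge_val w n u v = 0"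

text \<open>Registers: 0, 1, 2 are loop variables, 3, 4, 8, 10, 11 temporaries, 5 a counter, 6 the length of
  the output, 7 a flag, 9 the constant 1. Arrays: 0 the row offsets \<open>1 + i * n\<close>, 1 and 3 the
  characteristic functions of the heavy and the medium vertices, 2 the light degrees plus one, 4 the
  visited vertices, 5 the output.\<close>

definition Skip :: com where
  "Skip = Const 15 0"

definition Edge :: "nat \<Rightarrow> nat \<Rightarrow> com" where
  "Edge u v = Minus 8 v u ;; Cond 8 (Get 8 0 v ;; Plus 8 8 u ;; Peek 4 8)
     (Minus 8 u v ;; Cond 8 (Get 8 0 u ;; Plus 8 8 v ;; Peek 4 8) (Const 4 1))"

text \<open>Convention for tests: register 4 is 0 on success, matching the weight of the edges
  sought. Successes are added to register 5.\<close>

definition Count :: "com \<Rightarrow> com" where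
  "Count c = For 1 (c ;; Cond 4 Skip (Plus 5 5 9))"

definition Rows :: com where
  "Rows = Const 9 1 ;; Const 8 1 ;; Num 10 ;; For 0 (Put 0 0 8 ;; Plus 8 8 10)"

text \<open>Register 5 starts at 1, so register 3 ends as \<open>4 * (deg + 1) + 1 - n\<close>,
  which under truncated subtraction is nonzero iff \<open>n \<le> 4 * (deg + 1)\<close>.\<close>

definition Mark_heavy :: com where
  "Mark_heavy = For 0 (Const 5 1 ;; Count (Edge 0 1) ;; Plus 3 5 5 ;; Plus 3 3 3 ;; Plus 3 3 9 ;;
     Num 10 ;; Minus 3 3 10 ;; Cond 3 (Put 1 0 9) Skip)"

text \<open>A heavy neighbour leaves its nonzero mark in register 4 and so fails the test.\<close>

definition Light_degrees :: com where
  "Light_degrees = For 0 (Const 5 1 ;; Count (Get 4 1 1 ;; Cond 4 Skip (Edge 0 1)) ;; Put 2 0 5)"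

text \<open>The final difference is the light degree plus 2 minus three times the rank, nonzero iff
  the inequality in \<open>medium\<close> holds.\<close>

definition Mark_medium :: com where
  "Mark_medium = For 0 (Const 5 0 ;;
     Count (Get 4 1 1 ;; Cond 4 Skip (Get 10 2 0 ;; Get 11 2 1 ;; Minus 4 10 11)) ;;
     Get 3 1 0 ;; Cond 3 Skip (Get 10 2 0 ;; Plus 10 10 9 ;; Plus 11 5 5 ;; Plus 11 11 5 ;;
       Minus 10 10 11 ;; Cond 10 (Put 3 0 9) Skip))"

definition Visit :: "nat \<Rightarrow> com" where
  "Visit x = Get 3 4 x ;; Cond 3 Skip (Put 4 x 9 ;; Put 5 6 x ;; Plus 6 6 9)"

text \<open>Register 3 adds up the heavy, medium and visited marks and the edge value, so it is 0
  exactly for an unvisited small neighbour. Register 7 stops the search after the first hit.\<close>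

definition Pick :: com where
  "Pick = Const 7 0 ;; For 2 (Cond 7 Skip
     (((Get 3 1 2 ;; Get 4 3 2 ;; Plus 3 3 4 ;; Get 4 4 2 ;; Plus 3 3 4) ;; Edge 0 2 ;; Plus 3 3 4) ;;
      Cond 3 Skip (Visit 2 ;; Const 7 1)))"

definition Cherries :: "nat \<Rightarrow> com" where
  "Cherries k = For 0 (Get 3 k 0 ;; Cond 3 (Pick ;; Visit 0 ;; Pick) Skip)"

text \<open>Medium vertices go first: with \<open>b\<close> medium and \<open>a\<close> heavy
  vertices, a medium vertex is only sure of \<open>2 b\<close> small neighbours, whereas a heavy one
  has \<open>2 (a + b)\<close> and can afford the losses to all other paths.\<close>

definition Main :: com where
  "Main = Rows ;; Mark_heavy ;; Light_degrees ;; Mark_medium ;; Const 6 0 ;;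
     Cherries 3 ;; Cherries 1 ;; For 0 (Visit 0)"

lemmas com_defs = Skip_def Edge_def Count_def Rows_def Mark_heavy_def Light_degrees_def Mark_medium_def
  Visit_def Pick_def Cherries_def Main_def

lemma wf_Main: "wf_com Main"
  by (simp add: com_defs)

text \<open>Loops are nested at most two deep, so the cost is in fact quadratic.\<close>

lemma cost_Main: "n \<ge> 1 \<Longrightarrow> cost n Main + 11 * n + 65 \<le> 2000 * n ^ 4"
proof -
  assume "n \<ge> 1"
  then have "n \<le> n ^ 2" "n ^ 2 \<le> n ^ 4" "1 \<le> n ^ 4"
    by (simp_all add: self_le_power power_increasing)
  moreover have "cost n Main + 11 * n + 65 = 90 + 223 * n + 533 * n ^ 2"
    by (simp add: com_defs algebra_simps power2_eq_square)
  ultimately show ?thesis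
    by linarith
qed

section \<open>Correctness of the marking phases\<close>

lemma Edge_correct:
  assumes "\<forall>i<n. snd s 0 i = 1 + i * n" "fst s u < n" "fst s v < n" "u \<notin> {4, 8}" "v \<notin> {4, 8}"
  shows "fst (sem w n (Edge u v) s) 4 = edge_val w n (fst s u) (fst s v)"
proof -
  consider "fst s u < fst s v" | "fst s v < fst s u" | "fst s u = fst s v" by linarith
  then show ?thesis
    using assms by cases (auto simp: Edge_def set_reg_def edge_val_def max_def min_def)
qed

lemma Count_correct:
  assumes "snd s = a" "fst s 0 = u" "fst s 9 = 1" "writes c \<inter> {0, 1, 5, 9} = {}" "puts c = {}"
    and test: "\<And>s i. i < n \<Longrightarrow> snd s = a \<Longrightarrow> fst s 0 = u \<Longrightarrow> fst s 1 = i \<Longrightarrow>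
      fst (sem w n c s) 4 = 0 \<longleftrightarrow> Q i"
  shows "fst (sem w n (Count c) s) 5 = fst s 5 + card {i. i < n \<and> Q i}"
proof -
  define x where "x = fst s 5"
  let ?I = "\<lambda>i s. snd s = a \<and> fst s 0 = u \<and> fst s 9 = 1 \<and> fst s 5 = x + card {j. j < i \<and> Q j}"
  have step: "?I (Suc i) (sem w n (c ;; Cond 4 Skip (Plus 5 5 9)) (set_reg 1 i s))"
    if "i < n" "?I i s" for i s
  proof -
    let ?s = "set_reg 1 i s"
    let ?t = "sem w n c ?s"
    have t: "fst ?t r = fst ?s r" if "r \<in> {0, 1, 5, 9}" for r
      by (rule sem_keeps) (use that assms(4) in blast)
    have a: "snd ?t = a"
      using sem_keeps_array[of _ c w n ?s] assms(5) that(2) by (simp add: set_reg_def ext)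
    have q: "fst ?t 4 = 0 \<longleftrightarrow> Q i"
      using that by (intro test) (auto simp: set_reg_def)
    have "{j. j < Suc i \<and> Q j} = (if Q i then insert i {j. j < i \<and> Q j} else {j. j < i \<and> Q j})"
      by (auto simp: less_Suc_eq)
    then have "card {j. j < Suc i \<and> Q j} = card {j. j < i \<and> Q j} + (if Q i then 1 else 0)"
      by simp
    then show ?thesis
      using t a q that(2) by (auto simp: Skip_def set_reg_def)
  qed
  obtain s' where "?I n s'" "sem w n (Count c) s = set_reg 1 n s'"
    using sem_For_invariant[of ?I s n w "c ;; Cond 4 Skip (Plus 5 5 9)" 1] step assms(1-3)
    unfolding Count_def x_def by auto
  then show ?thesis
    by (simp add: set_reg_def x_def)
qed

lemma Count_keeps:
  assumes "r \<notin> writes c \<union> {1, 5, 15}" shows "fst (sem w n (Count c) s) r = fst s r"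
  by (rule sem_keeps) (use assms in \<open>auto simp: Count_def Skip_def\<close>)

lemma Count_keeps_arrays:
  assumes "puts c = {}" shows "snd (sem w n (Count c) s) = snd s"
  by (rule ext, rule sem_keeps_array) (use assms in \<open>auto simp: Count_def Skip_def\<close>)

definition ready :: "nat \<Rightarrow> store \<Rightarrow> bool" where
  "ready n s \<longleftrightarrow> fst s 9 = 1 \<and> (\<forall>i<n. snd s 0 i = 1 + i * n)"

lemma ready_sem: "ready n s \<Longrightarrow> 9 \<notin> writes c \<Longrightarrow> 0 \<notin> puts c \<Longrightarrow> ready n (sem w n c s)"
  by (simp add: ready_def sem_keeps sem_keeps_array)

lemma ready_set_reg [simp]: "r \<noteq> 9 \<Longrightarrow> ready n (set_reg r x s) = ready n s"
  by (simp add: ready_def set_reg_def)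

lemma Rows_correct: "ready n (sem w n Rows s)"
proof -
  let ?I = "\<lambda>i s. fst s 9 = 1 \<and> fst s 8 = 1 + i * n \<and> fst s 10 = n \<and> (\<forall>j<i. snd s 0 j = 1 + j * n)"
  let ?s = "sem w n (Const 9 1 ;; Const 8 1 ;; Num 10) s"
  have "?I 0 ?s" by (simp add: set_reg_def)
  from sem_For_invariant[of ?I, OF this, of n w "Put 0 0 8 ;; Plus 8 8 10" 0]
  obtain s' where "?I n s'" "sem w n (For 0 (Put 0 0 8 ;; Plus 8 8 10)) ?s = set_reg 0 n s'"
    by (auto simp: set_reg_def less_Suc_eq)
  then show ?thesis
    by (simp add: Rows_def ready_def set_reg_def)
qed

lemma Mark_heavy_correct:
  assumes "ready n s" "snd s 1 = (\<lambda>_. 0)"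
  shows "snd (sem w n Mark_heavy s) 1 = (\<lambda>v. if v < n \<and> heavy (adj w n) n v then 1 else 0)"
proof -
  let ?A = "\<lambda>v. heavy (adj w n) n v"
  let ?I = "\<lambda>i s. ready n s \<and> snd s 1 = (\<lambda>v. if v < i \<and> ?A v then 1 else 0)"
  let ?c1 = "Const 5 1 ;; Count (Edge 0 1)"
  let ?c2 = "Plus 3 5 5 ;; Plus 3 3 3 ;; Plus 3 3 9 ;; Num 10 ;; Minus 3 3 10 ;; Cond 3 (Put 1 0 9) Skip"
  have step: "?I (Suc i) (sem w n ?c2 (sem w n ?c1 (set_reg 0 i s)))" if "i < n" "?I i s" for i s
  proof -
    let ?s = "sem w n (Const 5 1) (set_reg 0 i s)"
    define t where "t = sem w n (Count (Edge 0 1)) ?s"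
    have eq: "sem w n ?c2 (sem w n ?c1 (set_reg 0 i s)) = sem w n ?c2 t"
      by (simp add: t_def)
    have "fst t 5 = fst ?s 5 + card {v. v < n \<and> adj w n i v}"
      unfolding t_def
    proof (rule Count_correct[where a = "snd s" and u = i])
      fix s' :: store and j assume "j < n" "snd s' = snd s" "fst s' 0 = i" "fst s' 1 = j"
      then show "fst (sem w n (Edge 0 1) s') 4 = 0 \<longleftrightarrow> adj w n i j"
        using Edge_correct[of n s' 0 1 w] that by (simp add: ready_def adj_def)
    qed (use that in \<open>auto simp: set_reg_def ready_def Edge_def\<close>)
    moreover have "fst t 0 = i" "fst t 9 = 1" "snd t = snd s"
      using that by (simp_all add: t_def Count_keeps Count_keeps_arrays Edge_def set_reg_def ready_def)
    ultimately have "?I (Suc i) (sem w n ?c2 t)"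
      using that by (auto simp: Skip_def set_reg_def heavy_def ready_def less_Suc_eq fun_eq_iff)
    then show ?thesis
      unfolding eq .
  qed
  have "?I 0 s" using assms by simp
  from sem_For_invariant[of ?I, OF this, of n w "?c1 ;; ?c2" 0] step
  obtain s' where s': "?I n s'" "sem w n (For 0 (?c1 ;; ?c2)) s = set_reg 0 n s'"
    by auto
  have "sem w n Mark_heavy s = sem w n (For 0 (?c1 ;; ?c2)) s"
    by (simp add: Mark_heavy_def)
  with s' show ?thesis
    by (simp add: set_reg_def)
qed

lemma Light_degrees_correct:
  assumes "ready n s" "snd s 1 = (\<lambda>v. if v < n \<and> heavy (adj w n) n v then 1 else 0)"
  shows "\<forall>v<n. snd (sem w n Light_degrees s) 2 v = light_degree (adj w n) n v + 1"
proof -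
  let ?A = "\<lambda>v. heavy (adj w n) n v"
  let ?I = "\<lambda>i s. ready n s \<and> snd s 1 = (\<lambda>v. if v < n \<and> ?A v then 1 else 0) \<and>
    (\<forall>v<i. snd s 2 v = light_degree (adj w n) n v + 1)"
  let ?t = "Get 4 1 1 ;; Cond 4 Skip (Edge 0 1)"
  let ?c = "Const 5 1 ;; Count ?t ;; Put 2 0 5"
  have step: "?I (Suc i) (sem w n ?c (set_reg 0 i s))" if "i < n" "?I i s" for i s
  proof -
    let ?s = "sem w n (Const 5 1) (set_reg 0 i s)"
    define t where "t = sem w n (Count ?t) ?s"
    have eq: "sem w n ?c (set_reg 0 i s) = sem w n (Put 2 0 5) t"
      by (simp add: t_def)
    have "fst t 5 = fst ?s 5 + card {v. v < n \<and> \<not> ?A v \<and> adj w n i v}"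
      unfolding t_def
    proof (rule Count_correct[where a = "snd s" and u = i])
      fix s' :: store and j assume s': "j < n" "snd s' = snd s" "fst s' 0 = i" "fst s' 1 = j"
      show "fst (sem w n ?t s') 4 = 0 \<longleftrightarrow> \<not> ?A j \<and> adj w n i j"
      proof (cases "?A j")
        case True
        with s' that show ?thesis by (simp add: set_reg_def Skip_def)
      next
        case False
        then have "sem w n ?t s' = sem w n (Edge 0 1) (set_reg 4 0 s')"
          using s' that by (simp add: set_reg_def)
        then show ?thesis
          using Edge_correct[of n "set_reg 4 0 s'" 0 1 w] s' that False
          by (simp add: ready_def adj_def set_reg_def)
      qed
    qed (use that in \<open>auto simp: set_reg_def ready_def Edge_def Skip_def\<close>)
    moreover have "fst t 0 = i" "fst t 9 = 1" "snd t = snd s"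
      using that by (simp_all add: t_def Count_keeps Count_keeps_arrays Edge_def Skip_def set_reg_def ready_def)
    ultimately have "?I (Suc i) (sem w n (Put 2 0 5) t)"
      using that by (auto simp: set_reg_def light_degree_def ready_def less_Suc_eq)
    then show ?thesis
      unfolding eq .
  qed
  have "?I 0 s" using assms by simp
  from sem_For_invariant[of ?I, OF this, of n w ?c 0] step
  obtain s' where s': "?I n s'" "sem w n (For 0 ?c) s = set_reg 0 n s'"
    by blast
  then show ?thesis
    by (simp add: set_reg_def Light_degrees_def)
qed

lemma Mark_medium_correct:
  assumes "ready n s" "snd s 1 = (\<lambda>v. if v < n \<and> heavy (adj w n) n v then 1 else 0)"
    "\<forall>v<n. snd s 2 v = light_degree (adj w n) n v + 1" "snd s 3 = (\<lambda>_. 0)"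
  shows "snd (sem w n Mark_medium s) 3 = (\<lambda>v. if v < n \<and> medium (adj w n) n v then 1 else 0)"
proof -
  let ?A = "\<lambda>v. heavy (adj w n) n v" and ?d = "\<lambda>v. light_degree (adj w n) n v"
  let ?I = "\<lambda>i s. ready n s \<and> snd s 1 = (\<lambda>v. if v < n \<and> ?A v then 1 else 0) \<and>
    (\<forall>v<n. snd s 2 v = ?d v + 1) \<and>
    snd s 3 = (\<lambda>v. if v < i \<and> medium (adj w n) n v then 1 else 0)"
  let ?t = "Get 4 1 1 ;; Cond 4 Skip (Get 10 2 0 ;; Get 11 2 1 ;; Minus 4 10 11)"
  let ?c2 = "Get 3 1 0 ;; Cond 3 Skip (Get 10 2 0 ;; Plus 10 10 9 ;;
    Plus 11 5 5 ;; Plus 11 11 5 ;; Minus 10 10 11 ;; Cond 10 (Put 3 0 9) Skip)"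
  let ?c = "Const 5 0 ;; Count ?t ;; ?c2"
  have step: "?I (Suc i) (sem w n ?c (set_reg 0 i s))" if "i < n" "?I i s" for i s
  proof -
    let ?s = "sem w n (Const 5 0) (set_reg 0 i s)"
    define t where "t = sem w n (Count ?t) ?s"
    have eq: "sem w n ?c (set_reg 0 i s) = sem w n ?c2 t"
      by (simp add: t_def)
    have "fst t 5 = fst ?s 5 + card {v. v < n \<and> \<not> ?A v \<and> ?d i \<le> ?d v}"
      unfolding t_def
    proof (rule Count_correct[where a = "snd s" and u = i])
      fix s' :: store and j assume s': "j < n" "snd s' = snd s" "fst s' 0 = i" "fst s' 1 = j"
      show "fst (sem w n ?t s') 4 = 0 \<longleftrightarrow> \<not> ?A j \<and> ?d i \<le> ?d j"
        using s' that by (auto simp: set_reg_def Skip_def)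
    qed (use that in \<open>auto simp: set_reg_def ready_def Skip_def\<close>)
    moreover have "fst t 0 = i" "fst t 9 = 1" "snd t = snd s"
      using that by (simp_all add: t_def Count_keeps Count_keeps_arrays Skip_def set_reg_def ready_def)
    ultimately have "?I (Suc i) (sem w n ?c2 t)"
      using that by (auto simp: Skip_def set_reg_def medium_def degree_rank_def ready_def less_Suc_eq fun_eq_iff)
    then show ?thesis
      unfolding eq .
  qed
  have "?I 0 s" using assms by simp
  from sem_For_invariant[of ?I, OF this, of n w ?c 0] step
  obtain s' where s': "?I n s'" "sem w n (For 0 ?c) s = set_reg 0 n s'"
    by blast
  then show ?thesis
    by (simp add: set_reg_def Mark_medium_def)
qed

section \<open>Correctness of the construction of the cycle\<close>

definition out_list :: "store \<Rightarrow> nat list \<Rightarrow> bool" where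
  "out_list s L \<longleftrightarrow> fst s 6 = length L \<and> map (snd s 5) [0..<length L] = L \<and>
     (\<forall>v. snd s 4 v \<noteq> 0 \<longleftrightarrow> v \<in> set L)"

lemma out_list_keeps:
  "out_list s L \<Longrightarrow> 6 \<notin> writes c \<Longrightarrow> puts c \<inter> {4, 5} = {} \<Longrightarrow> out_list (sem w n c s) L"
  by (simp add: out_list_def sem_keeps sem_keeps_array)

lemma out_list_set_reg [simp]: "r \<noteq> 6 \<Longrightarrow> out_list (set_reg r x s) L = out_list s L"
  by (simp add: out_list_def set_reg_def)

definition visit :: "nat \<Rightarrow> nat list \<Rightarrow> nat list" where
  "visit v L = (if v \<in> set L then L else L @ [v])"

lemma Visit_correct:
  assumes "out_list s L" "fst s 9 = 1" "x \<noteq> 3"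
  shows "out_list (sem w n (Visit x) s) (visit (fst s x) L)"
proof (cases "fst s x \<in> set L")
  case True
  with assms show ?thesis
    by (auto simp: Visit_def visit_def out_list_def set_reg_def Skip_def)
next
  case False
  then have "snd s 4 (fst s x) = 0"
    using assms by (auto simp: out_list_def)
  moreover have "map ((snd s 5)(length L := y)) [0..<length L] = map (snd s 5) [0..<length L]" for y
    by simp
  ultimately show ?thesis
    using assms False
    by (auto simp: Visit_def visit_def out_list_def set_reg_def Skip_def simp del: map_eq_conv)
qed

definition marked :: "(nat \<Rightarrow> nat) \<Rightarrow> nat \<Rightarrow> store \<Rightarrow> bool" where
  "marked w n s \<longleftrightarrow> ready n s \<and> snd s 1 = (\<lambda>v. if v < n \<and> heavy (adj w n) n v then 1 else 0) \<and>
     snd s 3 = (\<lambda>v. if v < n \<and> medium (adj w n) n v then 1 else 0)"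

lemma marked_sem:
  "marked w n s \<Longrightarrow> 9 \<notin> writes c \<Longrightarrow> puts c \<inter> {0, 1, 3} = {} \<Longrightarrow> marked w n (sem w n c s)"
  by (simp add: marked_def ready_sem sem_keeps_array)

lemma marked_set_reg [simp]: "r \<noteq> 9 \<Longrightarrow> marked w n (set_reg r x s) = marked w n s"
  by (simp add: marked_def) (simp add: set_reg_def)

text \<open>The second alternative covers a vertex that has run out of unvisited small neighbours.
  It keeps the output a list of distinct vertices on every instance, dense or not.\<close>

definition picked :: "(nat \<Rightarrow> nat \<Rightarrow> bool) \<Rightarrow> nat \<Rightarrow> nat \<Rightarrow> nat list \<Rightarrow> nat list \<Rightarrow> bool" where
  "picked E n v L L' \<longleftrightarrow> (\<exists>x \<in> small_nbrs E n v - set L. L' = L @ [x]) \<or>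
     small_nbrs E n v \<subseteq> set L \<and> L' = L"

lemma Pick_correct:
  assumes "marked w n s" "out_list s L" "fst s 0 = v" "v < n"
  shows "\<exists>L'. out_list (sem w n Pick s) L' \<and> picked (adj w n) n v L L'"
proof -
  let ?N = "small_nbrs (adj w n) n v"
  let ?I = "\<lambda>i s. marked w n s \<and> fst s 0 = v \<and>
    (fst s 7 = 0 \<and> out_list s L \<and> {x \<in> ?N. x < i} \<subseteq> set L \<or>
     fst s 7 \<noteq> 0 \<and> (\<exists>x \<in> ?N - set L. out_list s (L @ [x])))"
  let ?c1 = "Get 3 1 2 ;; Get 4 3 2 ;; Plus 3 3 4 ;; Get 4 4 2 ;; Plus 3 3 4"
  let ?c2 = "?c1 ;; Edge 0 2 ;; Plus 3 3 4"
  let ?b = "Cond 7 Skip (?c2 ;; Cond 3 Skip (Visit 2 ;; Const 7 1))"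
  have step: "?I (Suc i) (sem w n ?b (set_reg 2 i s))" if "i < n" "?I i s" for i s
  proof -
    have "marked w n (sem w n ?b (set_reg 2 i s))"
      by (rule marked_sem) (use that in \<open>simp_all add: com_defs\<close>)
    moreover have "fst (sem w n ?b (set_reg 2 i s)) 0 = fst (set_reg 2 i s) 0"
      by (rule sem_keeps) (simp add: com_defs)
    ultimately have m: "marked w n (sem w n ?b (set_reg 2 i s))" "fst (sem w n ?b (set_reg 2 i s)) 0 = v"
      using that by (simp_all add: set_reg_def)
    show ?thesis
    proof (cases "fst s 7 = 0")
      case False
      then have "sem w n ?b (set_reg 2 i s) = set_reg 15 0 (set_reg 2 i s)"
        by (simp add: set_reg_def Skip_def)
      moreover have "fst (set_reg 15 0 (set_reg 2 i s)) 7 = fst s 7"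
        by (simp add: set_reg_def)
      ultimately show ?thesis
        using m that False by auto
    next
      case True
      then have L: "out_list s L" "{x \<in> ?N. x < i} \<subseteq> set L" "marked w n s" "fst s 0 = v"
        using that by auto
      define s1 where "s1 = sem w n ?c1 (set_reg 2 i s)"
      define t where "t = sem w n ?c2 (set_reg 2 i s)"
      have s: "fst s1 0 = v" "fst s1 2 = i" "snd s1 = snd s"
        using L by (simp_all add: s1_def set_reg_def)
      have e: "fst (sem w n (Edge 0 2) s1) 4 = edge_val w n v i"
        using Edge_correct[of n s1 0 2 w] s that(1) L(3) \<open>v < n\<close> by (simp add: marked_def ready_def)
      have "fst (sem w n (Edge 0 2) s1) 3 = fst s1 3"
        by (rule sem_keeps) (simp add: Edge_def)
      also have "\<dots> = snd s 1 i + snd s 3 i + snd s 4 i"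
        by (simp add: s1_def set_reg_def)
      finally have "fst t 3 = snd s 1 i + snd s 3 i + snd s 4 i + edge_val w n v i"
        using e by (simp add: t_def s1_def set_reg_def)
      moreover have "snd s 4 i = 0 \<longleftrightarrow> i \<notin> set L"
        using L(1) unfolding out_list_def by blast
      ultimately have t3: "fst t 3 = 0 \<longleftrightarrow> i \<in> ?N - set L"
        using L that(1) by (auto simp: marked_def small_nbrs_def adj_def)
      have "fst t r = fst (set_reg 2 i s) r" if "r \<in> {2, 7, 9}" for r
        unfolding t_def by (rule sem_keeps) (use that in \<open>auto simp: Edge_def\<close>)
      then have t: "fst t 7 = 0" "fst t 2 = i" "fst t 9 = 1"
        using True L(3) by (simp_all add: set_reg_def marked_def ready_def)
      have o: "out_list t L"
        unfolding t_def by (rule out_list_keeps) (use L in \<open>simp_all add: Edge_def\<close>)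
      have b: "sem w n ?b (set_reg 2 i s) = sem w n (Cond 3 Skip (Visit 2 ;; Const 7 1)) t"
        using True by (simp add: t_def set_reg_def)
      show ?thesis
      proof (cases "fst t 3 = 0")
        case True
        then have "sem w n ?b (set_reg 2 i s) = set_reg 7 1 (sem w n (Visit 2) t)"
          unfolding b by simp
        moreover have "out_list (sem w n (Visit 2) t) (L @ [i])"
          using Visit_correct[OF o t(3), of 2 w n] True t3 t(2) by (simp add: visit_def)
        moreover have "fst (set_reg 7 1 x) 7 \<noteq> 0" for x :: store
          by (simp add: set_reg_def)
        ultimately have "fst (sem w n ?b (set_reg 2 i s)) 7 \<noteq> 0"
          "out_list (sem w n ?b (set_reg 2 i s)) (L @ [i])"
          by (simp_all only: out_list_set_reg) simp
        with m True t3 show ?thesis by blast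
      next
        case False
        then have "sem w n ?b (set_reg 2 i s) = set_reg 15 0 t"
          unfolding b by (simp add: Skip_def)
        moreover have "out_list (set_reg 15 0 t) L" "fst (set_reg 15 0 t) 7 = 0"
          using o t(1) by (simp_all only: out_list_set_reg) (simp_all add: set_reg_def)
        moreover have "{x \<in> ?N. x < Suc i} \<subseteq> set L"
          using False t3 L(2) by (auto simp: less_Suc_eq)
        ultimately show ?thesis using m by metis
      qed
    qed
  qed
  have "?I 0 (set_reg 7 0 s)"
    using assms by simp (simp add: set_reg_def)
  from sem_For_invariant[of ?I, OF this, of n w ?b 2] step
  obtain s' where s': "?I n s'" "sem w n (For 2 ?b) (set_reg 7 0 s) = set_reg 2 n s'"
    by blast
  have P: "sem w n Pick s = set_reg 2 n s'"
    using s'(2) by (simp add: Pick_def)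
  have N: "{x \<in> ?N. x < n} = ?N"
    by (auto simp: small_nbrs_def)
  from s'(1) consider "out_list s' L" "?N \<subseteq> set L" | x where "x \<in> ?N - set L" "out_list s' (L @ [x])"
    unfolding N by blast
  then show ?thesis
  proof cases
    case 1
    then show ?thesis
      unfolding P picked_def by (intro exI[of _ L]) simp
  next
    case 2
    then show ?thesis
      unfolding P picked_def by (intro exI[of _ "L @ [x]"]) auto
  qed
qed

definition chain :: "(nat \<times> nat \<times> nat) list \<Rightarrow> nat list" where
  "chain T = concat (map (\<lambda>(x, v, y). [x, v, y]) T)"

text \<open>A triple \<open>(x, v, y)\<close> stands for the path of length two with centre
  \<open>v\<close>. Disjointness of the paths comes separately, from the distinctness of the output
  list.\<close>

definition cherries :: "(nat \<Rightarrow> nat \<Rightarrow> bool) \<Rightarrow> nat \<Rightarrow> (nat \<times> nat \<times> nat) list \<Rightarrow> bool" where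
  "cherries E n T \<longleftrightarrow> (\<forall>(x, v, y) \<in> set T. (heavy E n v \<or> medium E n v) \<and>
     x \<in> small_nbrs E n v \<and> y \<in> small_nbrs E n v)"

lemma chain_simps: "chain [] = []" "chain (T @ [(x, v, y)]) = chain T @ [x, v, y]"
  by (simp_all add: chain_def)

text \<open>Centres are heavy or medium, so each triple contributes exactly two small vertices to
  the chain.\<close>

lemma cherries_count:
  assumes "cherries E n T"
  shows "card (small_nbrs E n v \<inter> set (chain T)) \<le> 2 * length T"
proof -
  let ?s = "\<lambda>u. \<not> heavy E n u \<and> \<not> medium E n u"
  have "length (filter ?s (chain T)) = 2 * length T"
    using assms by (induction T) (auto simp: cherries_def chain_def small_nbrs_def)
  moreover have "small_nbrs E n v \<inter> set (chain T) \<subseteq> set (filter ?s (chain T))"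
    by (auto simp: small_nbrs_def)
  ultimately show ?thesis
    by (metis card_length card_mono finite_set le_trans)
qed

lemma cherries_center:
  assumes "cherries E n T" "heavy E n v \<or> medium E n v" "v \<in> set (chain T)"
  shows "v \<in> (fst \<circ> snd) ` set T"
  using assms by (force simp: cherries_def chain_def small_nbrs_def)

lemma picked_distinct:
  assumes "picked E n v L L'" "distinct L" "set L \<subseteq> {..<n}"
  shows "distinct L'" "set L' \<subseteq> {..<n}"
  using assms by (auto simp: picked_def small_nbrs_def)

lemma finite_small_nbrs [simp]: "finite (small_nbrs E n v)"
  by (simp add: small_nbrs_def)

lemma picked_new:
  assumes "picked E n v L L'" "card (small_nbrs E n v \<inter> set L) < card (small_nbrs E n v)"
  shows "\<exists>x \<in> small_nbrs E n v. x \<notin> set L \<and> L' = L @ [x]"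
proof -
  have "\<not> small_nbrs E n v \<subseteq> set L"
    using assms(2) by (metis Int_absorb2 less_irrefl)
  with assms(1) show ?thesis
    by (auto simp: picked_def)
qed

text \<open>Earlier triples block at most \<open>2 * length T\<close> small neighbours of
  \<open>v\<close>, and \<open>x\<close> blocks one more; with \<open>2 * (length T + 1)\<close> of
  them there is a free one for each of the two picks.\<close>

lemma cherry_step:
  assumes "cherries E n T" "heavy E n v \<or> medium E n v" "v \<notin> (fst \<circ> snd) ` set T"
    and "2 * (length T + 1) \<le> card (small_nbrs E n v)"
    and "picked E n v (chain T) L1" "picked E n v (visit v L1) L2"
  shows "\<exists>x y. L2 = chain (T @ [(x, v, y)]) \<and> cherries E n (T @ [(x, v, y)])"
proof -
  let ?N = "small_nbrs E n v"
  have c: "card (?N \<inter> set (chain T)) \<le> 2 * length T"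
    by (rule cherries_count[OF assms(1)])
  then obtain x where x: "x \<in> ?N" "L1 = chain T @ [x]"
    using picked_new[OF assms(5)] assms(4) by auto
  have v: "v \<notin> set (chain T)" "v \<notin> ?N"
    using cherries_center[OF assms(1,2)] assms(2,3) by (auto simp: small_nbrs_def)
  then have vis: "visit v L1 = chain T @ [x, v]"
    using x by (auto simp: visit_def)
  have "?N \<inter> set (visit v L1) \<subseteq> insert x (?N \<inter> set (chain T))"
    using v vis by auto
  then have "card (?N \<inter> set (visit v L1)) \<le> card (insert x (?N \<inter> set (chain T)))"
    by (intro card_mono) auto
  also have "\<dots> \<le> 2 * length T + 1"
    using c by (simp add: card_insert_if)
  finally obtain y where y: "y \<in> ?N" "L2 = visit v L1 @ [y]"
    using picked_new[OF assms(6)] assms(4) by fastforce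
  have "L2 = chain (T @ [(x, v, y)])" "cherries E n (T @ [(x, v, y)])"
    using x y vis assms(1,2) by (auto simp: chain_simps cherries_def)
  then show ?thesis by blast
qed

lemma Cherry_correct:
  assumes "marked w n s" "out_list s L" "fst s 0 = v" "v < n"
  shows "\<exists>L1 L2. out_list (sem w n (Pick ;; Visit 0 ;; Pick) s) L2 \<and>
    picked (adj w n) n v L L1 \<and> picked (adj w n) n v (visit v L1) L2"
proof -
  obtain L1 where L1: "out_list (sem w n Pick s) L1" "picked (adj w n) n v L L1"
    using Pick_correct[OF assms] by blast
  have 1: "marked w n (sem w n Pick s)"
    by (rule marked_sem[OF assms(1)]) (simp_all add: com_defs)
  have 2: "fst (sem w n Pick s) 0 = v"
    unfolding assms(3)[symmetric] by (rule sem_keeps) (simp add: com_defs)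
  let ?t = "sem w n (Visit 0) (sem w n Pick s)"
  have 3: "out_list ?t (visit v L1)"
    using Visit_correct[OF L1(1), of 0 w n] 1 2 by (simp add: marked_def ready_def)
  have 4: "marked w n ?t"
    by (rule marked_sem[OF 1]) (simp_all add: com_defs)
  have "fst ?t 0 = fst (sem w n Pick s) 0"
    by (rule sem_keeps) (simp add: com_defs)
  with 2 have 5: "fst ?t 0 = v" by simp
  from Pick_correct[OF 4 3 5 assms(4)] L1(2) show ?thesis
    by auto
qed

text \<open>Distinctness is unconditional, since a Hamilton cycle must be output for every instance.
  The statement on triples is a conditional clause, to be activated only when the degree bounds are
  available.\<close>

lemma Cherries_correct:
  assumes "marked w n s" "out_list s L" "distinct L" "set L \<subseteq> {..<n}"
    and S: "S = {v. v < n \<and> snd s k v \<noteq> 0}" and "k = 1 \<or> k = 3"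
  shows "\<exists>L'. out_list (sem w n (Cherries k) s) L' \<and> distinct L' \<and> set L' \<subseteq> {..<n} \<and>
    (\<forall>T. L = chain T \<longrightarrow> cherries (adj w n) n T \<longrightarrow> S \<inter> (fst \<circ> snd) ` set T = {} \<longrightarrow>
      (\<forall>v\<in>S. 2 * (length T + card S) \<le> card (small_nbrs (adj w n) n v)) \<longrightarrow>
      (\<exists>T'. L' = chain T' \<and> cherries (adj w n) n T' \<and> length T' = length T + card S \<and>
         (fst \<circ> snd) ` set T' = (fst \<circ> snd) ` set T \<union> S))"
proof -
  let ?E = "adj w n"
  define spec where "spec i L' \<longleftrightarrow> (\<forall>T. L = chain T \<longrightarrow> cherries ?E n T \<longrightarrow> S \<inter> (fst \<circ> snd) ` set T = {} \<longrightarrow>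
      (\<forall>v\<in>S. 2 * (length T + card S) \<le> card (small_nbrs ?E n v)) \<longrightarrow>
      (\<exists>T'. L' = chain T' \<and> cherries ?E n T' \<and> length T' = length T + card {v\<in>S. v < i} \<and>
         (fst \<circ> snd) ` set T' = (fst \<circ> snd) ` set T \<union> {v\<in>S. v < i}))" for i :: nat and L'
  let ?I = "\<lambda>i s. marked w n s \<and> S = {v. v < n \<and> snd s k v \<noteq> 0} \<and>
    (\<exists>L'. out_list s L' \<and> distinct L' \<and> set L' \<subseteq> {..<n} \<and> spec i L')"
  let ?ch = "Pick ;; Visit 0 ;; Pick"
  let ?b = "Get 3 k 0 ;; Cond 3 ?ch Skip"
  have hm: "heavy ?E n v \<or> medium ?E n v" if "v \<in> S" for v
    using that assms(1,6) by (auto simp: S marked_def split: if_splits)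
  have fS: "finite S" by (simp add: S)
  have step: "?I (Suc i) (sem w n ?b (set_reg 0 i s))" if i: "i < n" and Is: "?I i s" for i s
  proof -
    obtain L1 where L1: "out_list s L1" "distinct L1" "set L1 \<subseteq> {..<n}" "spec i L1"
      using Is by blast
    define t where "t = set_reg 3 (snd s k i) (set_reg 0 i s)"
    have b: "sem w n ?b (set_reg 0 i s) = sem w n (Cond 3 ?ch Skip) t"
      by (simp add: t_def set_reg_def)
    have t: "marked w n t" "out_list t L1" "fst t 0 = i"
      using Is L1(1) by (simp_all add: t_def) (simp add: set_reg_def)
    have t3: "fst t 3 = snd s k i" "i \<in> S \<longleftrightarrow> snd s k i \<noteq> 0"
      using Is i by (simp_all add: t_def set_reg_def)
    have "marked w n (sem w n ?b (set_reg 0 i s))"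
      by (rule marked_sem) (use Is in \<open>simp_all add: com_defs\<close>)
    moreover have "snd (sem w n ?b (set_reg 0 i s)) k = snd (set_reg 0 i s) k"
      by (rule sem_keeps_array) (use assms(6) in \<open>auto simp: com_defs\<close>)
    then have "S = {v. v < n \<and> snd (sem w n ?b (set_reg 0 i s)) k v \<noteq> 0}"
      using Is by (simp add: set_reg_def)
    moreover have "\<exists>L'. out_list (sem w n ?b (set_reg 0 i s)) L' \<and> distinct L' \<and> set L' \<subseteq> {..<n} \<and>
      spec (Suc i) L'"
    proof (cases "i \<in> S")
      case False
      then have "{v\<in>S. v < Suc i} = {v\<in>S. v < i}"
        by (auto simp: less_Suc_eq)
      then have "spec (Suc i) L1"
        using L1(4) by (simp add: spec_def)
      moreover have "sem w n ?b (set_reg 0 i s) = set_reg 15 0 t"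
        unfolding b using t3 False by (simp add: Skip_def)
      ultimately show ?thesis
        using L1 t(2) by (metis out_list_set_reg numeral_eq_iff semiring_norm(88) num.distinct(3) num.inject(1,2))
    next
      case True
      then have "sem w n ?b (set_reg 0 i s) = sem w n ?ch t"
        unfolding b using t3 by simp
      moreover obtain L2 L3 where L3: "out_list (sem w n ?ch t) L3" "picked ?E n i L1 L2"
        "picked ?E n i (visit i L2) L3"
        using Cherry_correct[OF t i] by blast
      moreover have "distinct L3 \<and> set L3 \<subseteq> {..<n}"
      proof -
        have "distinct L2" "set L2 \<subseteq> {..<n}"
          using picked_distinct[OF L3(2)] L1 by auto
        then have "distinct (visit i L2)" "set (visit i L2) \<subseteq> {..<n}"
          using i by (auto simp: visit_def)
        then show ?thesis
          using picked_distinct[OF L3(3)] by blast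
      qed
      moreover have "spec (Suc i) L3"
        unfolding spec_def
      proof (intro allI impI)
        fix T
        assume T: "L = chain T" "cherries ?E n T" "S \<inter> (fst \<circ> snd) ` set T = {}"
          "\<forall>v\<in>S. 2 * (length T + card S) \<le> card (small_nbrs ?E n v)"
        then obtain T' where T': "L1 = chain T'" "cherries ?E n T'"
          "length T' = length T + card {v\<in>S. v < i}"
          "(fst \<circ> snd) ` set T' = (fst \<circ> snd) ` set T \<union> {v\<in>S. v < i}"
          using L1(4) unfolding spec_def by blast
        have "{v\<in>S. v < Suc i} = insert i {v\<in>S. v < i}"
          using True by auto
        then have ins: "{v\<in>S. v < Suc i} = insert i {v\<in>S. v < i}"
          "card {v\<in>S. v < Suc i} = card {v\<in>S. v < i} + 1"
          using fS by auto
        have "card {v\<in>S. v < Suc i} \<le> card S"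
          using fS by (intro card_mono) auto
        then have "2 * (length T' + 1) \<le> card (small_nbrs ?E n i)"
          using T(4) True T'(3) ins(2) by (smt (verit, best) add.assoc add_le_cancel_left le_trans mult_le_mono2)
        moreover have "i \<notin> (fst \<circ> snd) ` set T'"
          using T(3) T'(4) True by auto
        ultimately obtain x y where xy: "L3 = chain (T' @ [(x, i, y)])" "cherries ?E n (T' @ [(x, i, y)])"
          using cherry_step[OF T'(2) hm[OF True]] L3(2,3) unfolding T'(1) by blast
        have "length (T' @ [(x, i, y)]) = length T + card {v\<in>S. v < Suc i}"
          "(fst \<circ> snd) ` set (T' @ [(x, i, y)]) = (fst \<circ> snd) ` set T \<union> {v\<in>S. v < Suc i}"
          using T' ins by auto
        with xy show "\<exists>T'. L3 = chain T' \<and> cherries ?E n T' \<and> length T' = length T + card {v\<in>S. v < Suc i} \<and>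
          (fst \<circ> snd) ` set T' = (fst \<circ> snd) ` set T \<union> {v\<in>S. v < Suc i}"
          by blast
      qed
      ultimately show ?thesis by metis
    qed
    ultimately show ?thesis by blast
  qed
  have "spec 0 L"
    by (auto simp: spec_def)
  then have "?I 0 s"
    using assms by blast
  from sem_For_invariant[of ?I, OF this, of n w ?b 0] step
  obtain s' where s': "?I n s'" "sem w n (For 0 ?b) s = set_reg 0 n s'"
    by blast
  obtain L' where "out_list s' L'" "distinct L'" "set L' \<subseteq> {..<n}" "spec n L'"
    using s'(1) by blast
  moreover have "{v\<in>S. v < n} = S"
    by (auto simp: S)
  ultimately show ?thesis
    using s'(2) unfolding spec_def Cherries_def by (intro exI[of _ L']) simp
qed

lemma Rest_correct:
  assumes "ready n s" "out_list s L" "distinct L" "set L \<subseteq> {..<n}"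
  shows "\<exists>R. out_list (sem w n (For 0 (Visit 0)) s) (L @ R) \<and> distinct (L @ R) \<and> set (L @ R) = {..<n}"
proof -
  let ?I = "\<lambda>i s. ready n s \<and>
    (\<exists>R. out_list s (L @ R) \<and> distinct (L @ R) \<and> set (L @ R) \<subseteq> {..<n} \<and> {..<i} \<subseteq> set (L @ R))"
  have step: "?I (Suc i) (sem w n (Visit 0) (set_reg 0 i s))" if i: "i < n" and Is: "?I i s" for i s
  proof -
    obtain R where R: "out_list s (L @ R)" "distinct (L @ R)" "set (L @ R) \<subseteq> {..<n}" "{..<i} \<subseteq> set (L @ R)"
      using Is by blast
    have o: "out_list (sem w n (Visit 0) (set_reg 0 i s)) (visit i (L @ R))"
      using Visit_correct[of "set_reg 0 i s" "L @ R" 0 w n] R(1) Is by (simp add: ready_def) (simp add: set_reg_def)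
    have "ready n (sem w n (Visit 0) (set_reg 0 i s))"
      by (rule ready_sem) (use Is in \<open>simp_all add: com_defs\<close>)
    moreover have "\<exists>R'. visit i (L @ R) = L @ R' \<and> distinct (L @ R') \<and> set (L @ R') \<subseteq> {..<n} \<and>
        {..<Suc i} \<subseteq> set (L @ R')"
    proof (cases "i \<in> set (L @ R)")
      case True
      with R show ?thesis
        by (intro exI[of _ R]) (auto simp: visit_def lessThan_Suc)
    next
      case False
      with R i show ?thesis
        by (intro exI[of _ "R @ [i]"]) (auto simp: visit_def lessThan_Suc)
    qed
    ultimately show ?thesis using o by metis
  qed
  have "?I 0 s"
    using assms by (auto intro!: exI[of _ "[]"])
  from sem_For_invariant[of ?I, OF this, of n w "Visit 0" 0] step
  obtain s' where s': "?I n s'" "sem w n (For 0 (Visit 0)) s = set_reg 0 n s'"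
    by blast
  then obtain R where "out_list s' (L @ R)" "distinct (L @ R)" "set (L @ R) \<subseteq> {..<n}" "{..<n} \<subseteq> set (L @ R)"
    by blast
  with s'(2) show ?thesis
    by (intro exI[of _ R]) auto
qed

theorem Main_correct:
  fixes f :: "nat \<Rightarrow> nat" and w :: "nat \<Rightarrow> nat" and n :: nat
  defines "L \<equiv> map (snd (sem w n Main (f, \<lambda>_ _. 0)) 5) [0..<n]" and "E \<equiv> adj w n"
  shows "distinct L" and "set L = {..<n}"
    and "\<lbrakk>\<forall>v<n. medium E n v \<longrightarrow> 2 * card {v. v < n \<and> medium E n v} \<le> card (small_nbrs E n v);
      \<forall>v<n. heavy E n v \<longrightarrow> 2 * (card {v. v < n \<and> heavy E n v} + card {v. v < n \<and> medium E n v})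
        \<le> card (small_nbrs E n v)\<rbrakk>
      \<Longrightarrow> \<exists>T R. L = chain T @ R \<and> cherries E n T \<and>
        length T = card {v. v < n \<and> heavy E n v} + card {v. v < n \<and> medium E n v}"
proof -
  let ?A = "{v. v < n \<and> heavy E n v}" and ?B = "{v. v < n \<and> medium E n v}"
  define s0 where "s0 = sem w n Rows (f, \<lambda>_ _. 0)"
  define s1 where "s1 = sem w n Mark_heavy s0"
  define s2 where "s2 = sem w n Light_degrees s1"
  define s3 where "s3 = sem w n Mark_medium s2"
  define s4 where "s4 = set_reg 6 0 s3"
  define s5 where "s5 = sem w n (Cherries 3) s4"
  define s6 where "s6 = sem w n (Cherries 1) s5"
  define s7 where "s7 = sem w n (For 0 (Visit 0)) s6"
  have s7: "sem w n Main (f, \<lambda>_ _. 0) = s7"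
    by (simp add: Main_def s0_def s1_def s2_def s3_def s4_def s5_def s6_def s7_def)
  have r0: "ready n s0"
    unfolding s0_def by (rule Rows_correct)
  have a0: "snd s0 k = (\<lambda>_. 0)" if "k \<noteq> 0" for k
    using that unfolding s0_def by (subst sem_keeps_array) (auto simp: Rows_def)
  have r1: "ready n s1"
    unfolding s1_def by (rule ready_sem) (auto simp: r0 com_defs)
  have a1: "snd s1 1 = (\<lambda>v. if v < n \<and> heavy E n v then 1 else 0)"
    unfolding s1_def E_def using r0 a0[of 1] by (intro Mark_heavy_correct) auto
  have k1: "snd s1 k = (\<lambda>_. 0)" if "k > 1" for k
    using that a0[of k] unfolding s1_def by (subst sem_keeps_array) (auto simp: com_defs)
  have r2: "ready n s2"
    unfolding s2_def by (rule ready_sem[OF r1]) (auto simp: com_defs)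
  have a2: "\<forall>v<n. snd s2 2 v = light_degree E n v + 1"
    unfolding s2_def E_def using r1 a1 by (intro Light_degrees_correct) (auto simp: E_def)
  have k2: "snd s2 k = snd s1 k" if "k \<noteq> 2" for k
    using that unfolding s2_def by (subst sem_keeps_array) (auto simp: com_defs)
  have r3: "ready n s3"
    unfolding s3_def by (rule ready_sem[OF r2]) (auto simp: com_defs)
  have a3: "snd s3 3 = (\<lambda>v. if v < n \<and> medium E n v then 1 else 0)"
    unfolding s3_def E_def using r2 a1 a2 k2[of 1] k2[of 3] k1[of 3]
    by (intro Mark_medium_correct) (auto simp: E_def)
  have k3: "snd s3 k = snd s2 k" if "k \<noteq> 3" for k
    using that unfolding s3_def by (subst sem_keeps_array) (auto simp: com_defs)
  have m4: "marked w n s4"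
    using r3 a3 a1 k2[of 1] k3[of 1] by (simp add: s4_def marked_def E_def) (simp add: set_reg_def)
  have o4: "out_list s4 []"
    using k3[of 4] k2[of 4] k1[of 4] by (simp add: s4_def out_list_def set_reg_def)
  have B: "?B = {v. v < n \<and> snd s4 3 v \<noteq> 0}"
    using m4 by (auto simp: marked_def E_def)
  obtain L5 where L5: "out_list s5 L5" "distinct L5" "set L5 \<subseteq> {..<n}"
    and T5: "\<And>T. [] = chain T \<Longrightarrow> cherries E n T \<Longrightarrow> ?B \<inter> (fst \<circ> snd) ` set T = {} \<Longrightarrow>
      (\<forall>v\<in>?B. 2 * (length T + card ?B) \<le> card (small_nbrs E n v)) \<Longrightarrow>
      (\<exists>T'. L5 = chain T' \<and> cherries E n T' \<and> length T' = length T + card ?B \<and>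
         (fst \<circ> snd) ` set T' = (fst \<circ> snd) ` set T \<union> ?B)"
    using Cherries_correct[OF m4 o4 _ _ B] unfolding E_def[symmetric] s5_def[symmetric] by auto
  have m5: "marked w n s5"
    unfolding s5_def by (rule marked_sem[OF m4]) (auto simp: com_defs)
  have A: "?A = {v. v < n \<and> snd s5 1 v \<noteq> 0}"
    using m5 by (auto simp: marked_def E_def)
  obtain L6 where L6: "out_list s6 L6" "distinct L6" "set L6 \<subseteq> {..<n}"
    and T6: "\<And>T. L5 = chain T \<Longrightarrow> cherries E n T \<Longrightarrow> ?A \<inter> (fst \<circ> snd) ` set T = {} \<Longrightarrow>
      (\<forall>v\<in>?A. 2 * (length T + card ?A) \<le> card (small_nbrs E n v)) \<Longrightarrow>
      (\<exists>T'. L6 = chain T' \<and> cherries E n T' \<and> length T' = length T + card ?A \<and>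
         (fst \<circ> snd) ` set T' = (fst \<circ> snd) ` set T \<union> ?A)"
    using Cherries_correct[OF m5 L5 A] unfolding E_def[symmetric] s6_def[symmetric] by auto
  have "ready n s6"
    unfolding s6_def by (rule ready_sem) (use m5 in \<open>auto simp: marked_def com_defs\<close>)
  from Rest_correct[OF this L6] obtain R where
    R: "out_list s7 (L6 @ R)" "distinct (L6 @ R)" "set (L6 @ R) = {..<n}"
    unfolding s7_def by blast
  have "length (L6 @ R) = n"
    using distinct_card[OF R(2)] R(3) by simp
  then have L: "L = L6 @ R"
    using R(1) unfolding L_def s7 out_list_def by metis
  show "distinct L" "set L = {..<n}"
    using R L by auto
  assume h: "\<forall>v<n. medium E n v \<longrightarrow> 2 * card ?B \<le> card (small_nbrs E n v)"
    "\<forall>v<n. heavy E n v \<longrightarrow> 2 * (card ?A + card ?B) \<le> card (small_nbrs E n v)"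
  have "\<exists>T. L5 = chain T \<and> cherries E n T \<and> length T = card ?B \<and> (fst \<circ> snd) ` set T = ?B"
    using T5[of "[]"] h(1) by (auto simp: chain_simps cherries_def)
  then obtain T where T: "L5 = chain T" "cherries E n T" "length T = card ?B" "(fst \<circ> snd) ` set T = ?B"
    by blast
  have "?A \<inter> (fst \<circ> snd) ` set T = {}"
    unfolding T(4) by (auto simp: medium_def)
  moreover have "\<forall>v\<in>?A. 2 * (length T + card ?A) \<le> card (small_nbrs E n v)"
    using h(2) T(3) by (auto simp: add.commute)
  ultimately obtain T' where "L6 = chain T'" "cherries E n T'" "length T' = card ?A + card ?B"
    using T6[OF T(1,2)] T(3) by (auto simp: add.commute)
  then show "\<exists>T R. L = chain T @ R \<and> cherries E n T \<and> length T = card ?A + card ?B"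
    unfolding L by blast
qed

section \<open>Matchings\<close>

definition graph_edges :: "(nat \<Rightarrow> nat \<Rightarrow> bool) \<Rightarrow> nat \<Rightarrow> nat set set" where
  "graph_edges E n = {{u, v} | u v. u < n \<and> v < n \<and> u \<noteq> v \<and> E u v}"

definition matching :: "(nat \<Rightarrow> nat \<Rightarrow> bool) \<Rightarrow> nat \<Rightarrow> nat set set \<Rightarrow> bool" where
  "matching E n M \<longleftrightarrow> M \<subseteq> graph_edges E n \<and> (\<forall>e\<in>M. \<forall>f\<in>M. e \<noteq> f \<longrightarrow> e \<inter> f = {})"

lemma edges_eq: "edges n = {e. e \<subseteq> {..<n} \<and> card e = 2}"
  unfolding edges_def by (auto simp: card_2_iff)

lemma finite_edges [simp]: "finite (edges n)"
  unfolding edges_eq by (rule finite_subset[of _ "Pow {..<n}"]) auto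

lemma card_edges: "card (edges n) = n choose 2"
  unfolding edges_eq using n_subsets[of "{..<n}" 2] by simp

lemma graph_edges_subset: "graph_edges E n \<subseteq> edges n"
  unfolding graph_edges_def edges_def by auto

lemma finite_graph_edges [simp]: "finite (graph_edges E n)"
  using finite_subset[OF graph_edges_subset] by simp

lemma matching_finite: "matching E n M \<Longrightarrow> finite M"
  unfolding matching_def using finite_subset finite_graph_edges by blast

lemma card_Union_matching:
  assumes "M \<subseteq> edges n" "\<forall>e\<in>M. \<forall>f\<in>M. e \<noteq> f \<longrightarrow> e \<inter> f = {}"
  shows "card (\<Union>M) = 2 * card M" "\<Union>M \<subseteq> {..<n}" "finite (\<Union>M)"
proof -
  show s: "\<Union>M \<subseteq> {..<n}" using assms(1) by (auto simp: edges_eq)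
  then show "finite (\<Union>M)" using finite_subset by blast
  have "card (\<Union>M) = sum card M"
  proof (rule card_Union_disjoint)
    show "pairwise disjnt M" using assms(2) by (auto simp: pairwise_def disjnt_def)
    show "finite e" if "e \<in> M" for e
      using that assms(1) by (auto simp: edges_eq intro: finite_subset[of e "{..<n}"])
  qed
  also have "\<dots> = (\<Sum>e\<in>M. 2)"
    using assms(1) by (intro sum.cong) (auto simp: edges_eq)
  finally show "card (\<Union>M) = 2 * card M" by simp
qed

lemma disjoint_family_insert:
  assumes "\<forall>e\<in>M. \<forall>f\<in>M. e \<noteq> f \<longrightarrow> e \<inter> f = {}" "\<forall>e\<in>M. x \<inter> e = {}"
  shows "\<forall>e\<in>insert x M. \<forall>f\<in>insert x M. e \<noteq> f \<longrightarrow> e \<inter> f = {}"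
proof (intro ballI impI)
  fix e f assume ef: "e \<in> insert x M" "f \<in> insert x M" "e \<noteq> f"
  show "e \<inter> f = {}"
  proof (cases "e = x")
    case True
    with ef assms(2) show ?thesis by simp
  next
    case False
    with ef have "e \<in> M" by simp
    with ef assms show ?thesis by (cases "f = x") (simp_all add: Int_commute)
  qed
qed

text \<open>In the complete graph any two uncovered vertices form an edge, so the matching grows as
  long as two are left.\<close>

lemma extend_to_optimal_matching:
  assumes "M \<subseteq> edges n" "\<forall>e\<in>M. \<forall>f\<in>M. e \<noteq> f \<longrightarrow> e \<inter> f = {}"
  shows "\<exists>M'. M \<subseteq> M' \<and> optimal_matching n M'"
  using assms
proof (induction "n div 2 - card M" arbitrary: M)
  case 0
  have "2 * card M \<le> n"
    using card_Union_matching(1,2)[OF 0(2,3)] card_mono[of "{..<n}" "\<Union>M"] by simp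
  with 0 have "card M = n div 2" by linarith
  with 0 show ?case
    by (intro exI[of _ M]) (auto simp: optimal_matching_def)
next
  case (Suc k)
  have c: "card (\<Union>M) = 2 * card M" "\<Union>M \<subseteq> {..<n}" "finite (\<Union>M)"
    using card_Union_matching[OF Suc.prems] by auto
  have "card ({..<n} - \<Union>M) = n - 2 * card M"
    using c by (simp add: card_Diff_subset)
  moreover have "n - 2 * card M \<ge> 2" using Suc.hyps(2) by linarith
  ultimately obtain U where "U \<subseteq> {..<n} - \<Union>M" "card U = 2"
    by (metis obtain_subset_with_card_n)
  then obtain u v where uv: "u \<in> {..<n} - \<Union>M" "v \<in> {..<n} - \<Union>M" "u \<noteq> v"
    unfolding card_2_iff by auto
  let ?M = "insert {u, v} M"
  have fin: "finite M" using Suc.prems(1) finite_subset finite_edges by blast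
  have "{u, v} \<notin> M" using uv by auto
  then have "card ?M = Suc (card M)" using fin by simp
  then have k: "k = n div 2 - card ?M" using Suc.hyps(2) by simp
  have sub: "?M \<subseteq> edges n" using Suc.prems uv by (auto simp: edges_def)
  have "\<forall>e\<in>M. {u, v} \<inter> e = {}" using uv by auto
  with Suc.prems(2) have "\<forall>e\<in>?M. \<forall>f\<in>?M. e \<noteq> f \<longrightarrow> e \<inter> f = {}"
    by (rule disjoint_family_insert)
  from Suc.hyps(1)[OF k sub this] show ?case by auto
qed

lemma matching_insert:
  assumes "matching E n M" "u < n" "v < n" "E u v" "u \<noteq> v" "u \<notin> \<Union>M" "v \<notin> \<Union>M"
  shows "matching E n (insert {u, v} M)" "card (insert {u, v} M) = Suc (card M)"
proof -
  have "\<forall>e\<in>M. {u, v} \<inter> e = {}"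
    using assms(6,7) by auto
  then have "\<forall>e\<in>insert {u, v} M. \<forall>f\<in>insert {u, v} M. e \<noteq> f \<longrightarrow> e \<inter> f = {}"
    using assms(1) unfolding matching_def by (intro disjoint_family_insert) simp_all
  moreover have "{u, v} \<in> graph_edges E n"
    using assms unfolding graph_edges_def by blast
  ultimately show "matching E n (insert {u, v} M)"
    using assms(1) by (simp add: matching_def)
  have "{u, v} \<notin> M" using assms by auto
  then show "card (insert {u, v} M) = Suc (card M)"
    using matching_finite[OF assms(1)] by simp
qed

text \<open>Vertices of \<open>W\<close> are matched one at a time to partners outside
  \<open>W\<close>, so that the rest of \<open>W\<close> stays free. After treating \<open>S\<close>
  the blocked vertices number at most \<open>2 * (card M + card S) + card W - card S\<close>, less
  than the assumed degree as long as \<open>S\<close> is not all of \<open>W\<close>.\<close>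

lemma greedy_matching:
  assumes "matching E n M" "W \<subseteq> {..<n}" "W \<inter> \<Union>M = {}" "\<And>v. \<not> E v v"
    and deg: "\<And>v. v \<in> W \<Longrightarrow> 2 * (card M + card W) \<le> card {u. u < n \<and> E v u}"
  shows "\<exists>M'. matching E n M' \<and> card M' = card M + card W"
proof -
  have fW: "finite W" using assms(2) finite_subset by blast
  have "\<exists>M'. matching E n M' \<and> card M' = card M + card S \<and> S \<subseteq> \<Union>M' \<and> (W - S) \<inter> \<Union>M' = {}"
    if "S \<subseteq> W" for S
    using finite_subset[OF that fW] that
  proof (induction S rule: finite_induct)
    case empty
    then show ?case using assms(1,3) by (intro exI[of _ M]) auto
  next
    case (insert v S)
    then obtain M' where M': "matching E n M'" "card M' = card M + card S" "S \<subseteq> \<Union>M'" "(W - S) \<inter> \<Union>M' = {}"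
      by auto
    have M'e: "M' \<subseteq> edges n" "\<forall>e\<in>M'. \<forall>f\<in>M'. e \<noteq> f \<longrightarrow> e \<inter> f = {}"
      using M'(1) graph_edges_subset unfolding matching_def by blast+
    have "insert v S \<subseteq> W" using insert.prems .
    then have "card (insert v S) \<le> card W" using fW card_mono by blast
    then have cS: "Suc (card S) \<le> card W" using insert by simp
    have "\<Union>M' \<union> W = \<Union>M' \<union> (W - S)" using M'(3) by auto
    then have "card (\<Union>M' \<union> W) \<le> card (\<Union>M') + card (W - S)"
      by (simp add: card_Un_le)
    also have "\<dots> = 2 * card M' + (card W - card S)"
      using card_Union_matching(1)[OF M'e] insert by (simp add: card_Diff_subset)
    also have "\<dots> < 2 * (card M + card W)"
      using M'(2) cS by arith
    also have "\<dots> \<le> card {u. u < n \<and> E v u}" using deg insert by simp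
    finally have "\<not> {u. u < n \<and> E v u} \<subseteq> \<Union>M' \<union> W"
      using card_mono[of "\<Union>M' \<union> W"] card_Union_matching(3)[OF M'e] fW by (metis finite_Un not_less)
    then obtain u where u: "u < n" "E v u" "u \<notin> \<Union>M'" "u \<notin> W" by blast
    have v: "v < n" "v \<notin> \<Union>M'" "v \<noteq> u" using insert M'(4) assms(2,4) u by auto
    have "matching E n (insert {v, u} M')" "card (insert {v, u} M') = Suc (card M')"
      using matching_insert[OF M'(1) v(1) u(1,2)] v u by auto
    moreover have "insert v S \<subseteq> \<Union>(insert {v, u} M')" using M'(3) by auto
    moreover have "(W - insert v S) \<inter> \<Union>(insert {v, u} M') = {}" using M'(4) u by auto
    ultimately show ?case using M'(2) insert by (intro exI[of _ "insert {v, u} M'"]) auto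
  qed
  from this[of W] show ?thesis by auto
qed

text \<open>Each edge is charged to one of its endpoints in \<open>S\<close>.\<close>

lemma edges_covered_card:
  assumes "finite S" "\<And>u v. E u v \<Longrightarrow> E v u" "F \<subseteq> graph_edges E n" "\<And>e. e \<in> F \<Longrightarrow> e \<inter> S \<noteq> {}"
    and "\<And>v. v \<in> S \<Longrightarrow> card {u. u < n \<and> E v u} \<le> D"
  shows "card F \<le> card S * D"
proof -
  have "F \<subseteq> (\<Union>v\<in>S. (\<lambda>u. {v, u}) ` {u. u < n \<and> E v u})"
  proof
    fix e assume e: "e \<in> F"
    then obtain u v where uv: "e = {u, v}" "u < n" "v < n" "E u v" using assms(3) unfolding graph_edges_def by blast
    from assms(4)[OF e] uv(1) have "u \<in> S \<or> v \<in> S" by auto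
    then show "e \<in> (\<Union>v\<in>S. (\<lambda>u. {v, u}) ` {u. u < n \<and> E v u})"
      using uv assms(2) by (auto simp: insert_commute image_iff)
  qed
  then have "card F \<le> card (\<Union>v\<in>S. (\<lambda>u. {v, u}) ` {u. u < n \<and> E v u})"
    using assms(1) by (intro card_mono) auto
  also have "\<dots> \<le> (\<Sum>v\<in>S. card ((\<lambda>u. {v, u}) ` {u. u < n \<and> E v u}))"
    by (rule card_UN_le[OF assms(1)])
  also have "\<dots> \<le> (\<Sum>v\<in>S. D)"
    by (intro sum_mono order_trans[OF card_image_le assms(5)]) auto
  finally show ?thesis by simp
qed

lemma maximum_matching:
  assumes "\<And>M. matching E n M \<Longrightarrow> card M \<le> k"
  shows "\<exists>M. matching E n M \<and> (\<forall>M'. matching E n M' \<longrightarrow> card M' \<le> card M)"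
proof -
  have "matching E n {}" by (simp add: matching_def)
  then show ?thesis
    using ex_has_greatest_nat[of "matching E n" "{}" card "Suc k"] assms by (auto simp: le_imp_less_Suc)
qed

lemma maximum_matching_covers:
  assumes "matching E n M" "\<forall>M'. matching E n M' \<longrightarrow> card M' \<le> card M" "e \<in> graph_edges E n"
  shows "e \<inter> \<Union>M \<noteq> {}"
proof
  assume e: "e \<inter> \<Union>M = {}"
  obtain u v where "e = {u, v}" "u < n" "v < n" "u \<noteq> v" "E u v"
    using assms(3) unfolding graph_edges_def by blast
  with e have "u \<notin> \<Union>M" "v \<notin> \<Union>M" by auto
  from matching_insert[OF assms(1) \<open>u < n\<close> \<open>v < n\<close> \<open>E u v\<close> \<open>u \<noteq> v\<close> this] assms(2)
  show False by fastforce
qed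

section \<open>Structure of the graph of weight-zero edges\<close>

definition light_adj :: "(nat \<Rightarrow> nat \<Rightarrow> bool) \<Rightarrow> nat \<Rightarrow> nat \<Rightarrow> nat \<Rightarrow> bool" where
  "light_adj E n u v \<longleftrightarrow> E u v \<and> \<not> heavy E n u \<and> \<not> heavy E n v"

definition small_edges :: "(nat \<Rightarrow> nat \<Rightarrow> bool) \<Rightarrow> nat \<Rightarrow> nat set set" where
  "small_edges E n = {e \<in> graph_edges E n. \<forall>v\<in>e. \<not> heavy E n v \<and> \<not> medium E n v}"

lemma matching_mono: "matching (light_adj E n) n M \<Longrightarrow> matching E n M"
  unfolding matching_def graph_edges_def light_adj_def by blast

lemma light_nbrs: "\<not> heavy E n v \<Longrightarrow> {u. u < n \<and> light_adj E n v u} = {u. u < n \<and> \<not> heavy E n u \<and> E v u}"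
  by (auto simp: light_adj_def)

text \<open>Otherwise take \<open>k + 1 - card M\<close> heavy vertices. Their degree is at least
  \<open>2 * (k + 1)\<close>, twice the size aimed at, so greedy extension of \<open>M\<close>
  produces a matching with \<open>k + 1\<close> edges.\<close>

lemma card_heavy_plus_matching:
  assumes irr: "\<And>v. \<not> E v v" and k: "\<And>M. matching E n M \<Longrightarrow> card M \<le> k"
    and deg: "\<And>v. v < n \<Longrightarrow> heavy E n v \<Longrightarrow> 2 * k + 2 \<le> card {u. u < n \<and> E v u}"
    and M: "matching (light_adj E n) n M"
  shows "card {v. v < n \<and> heavy E n v} + card M \<le> k"
proof (rule ccontr)
  let ?A = "{v. v < n \<and> heavy E n v}"
  assume "\<not> ?thesis"
  then have "k + 1 - card M \<le> card ?A" by linarith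
  then obtain W where W: "W \<subseteq> ?A" "card W = k + 1 - card M"
    by (meson obtain_subset_with_card_n)
  have cM: "card M \<le> k" using k[OF matching_mono[OF M]] .
  have nh: "\<not> heavy E n v" if "v \<in> \<Union>M" for v
    using that M unfolding matching_def graph_edges_def light_adj_def by blast
  have "\<exists>M'. matching E n M' \<and> card M' = card M + card W"
  proof (rule greedy_matching[OF matching_mono[OF M] _ _ irr])
    show "W \<subseteq> {..<n}" using W(1) by auto
    show "W \<inter> \<Union>M = {}" using W(1) nh by blast
    show "2 * (card M + card W) \<le> card {u. u < n \<and> E v u}" if "v \<in> W" for v
      using that W deg[of v] cM by auto
  qed
  then obtain M' where "matching E n M'" "card M' = card M + card W" by blast
  with k[of M'] W(2) cM show False by simp
qed

text \<open>Edges without heavy endpoint are covered by the \<open>2 * card M\<close> matched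
  vertices, each of degree at most \<open>(n - 1) div 4\<close>; doubling turns this into
  \<open>card M * (n - 1)\<close>. All other edges are charged to heavy vertices.\<close>

lemma double_card_graph_edges_le:
  assumes sym: "\<And>u v. E u v \<Longrightarrow> E v u" and irr: "\<And>v. \<not> E v v"
    and M: "matching (light_adj E n) n M" and max: "\<forall>M'. matching (light_adj E n) n M' \<longrightarrow> card M' \<le> card M"
  shows "2 * card (graph_edges E n) \<le> (2 * card {v. v < n \<and> heavy E n v} + card M) * (n - 1)"
proof -
  let ?A = "{v. v < n \<and> heavy E n v}" and ?G = "graph_edges E n"
  have Me: "M \<subseteq> edges n" "\<forall>e\<in>M. \<forall>f\<in>M. e \<noteq> f \<longrightarrow> e \<inter> f = {}"
    using M graph_edges_subset unfolding matching_def by blast+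
  let ?F = "{e \<in> ?G. e \<inter> ?A \<noteq> {}}"
  have "card {u. u < n \<and> E v u} \<le> n - 1" if "v < n" for v
  proof -
    have "{u. u < n \<and> E v u} \<subseteq> {..<n} - {v}" using irr by auto
    then have "card {u. u < n \<and> E v u} \<le> card ({..<n} - {v})" by (intro card_mono) auto
    then show ?thesis using that by simp
  qed
  then have 1: "card ?F \<le> card ?A * (n - 1)"
    by (intro edges_covered_card[of _ E]) (auto intro: sym)
  have "card (?G - ?F) \<le> card (\<Union>M) * ((n - 1) div 4)"
  proof (rule edges_covered_card[of _ E])
    show "finite (\<Union>M)" using card_Union_matching(3)[OF Me] .
    show "E u v \<Longrightarrow> E v u" for u v by (rule sym)
    show "?G - ?F \<subseteq> ?G" by blast
    show "e \<inter> \<Union>M \<noteq> {}" if "e \<in> ?G - ?F" for e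
    proof -
      have "e \<in> graph_edges (light_adj E n) n"
        using that unfolding graph_edges_def light_adj_def by blast
      then show ?thesis using maximum_matching_covers[OF M max] by blast
    qed
    show "card {u. u < n \<and> E v u} \<le> (n - 1) div 4" if "v \<in> \<Union>M" for v
    proof -
      have "\<not> heavy E n v"
        using that M unfolding matching_def graph_edges_def light_adj_def by blast
      then show ?thesis unfolding heavy_def by (subst less_eq_div_iff_mult_less_eq) auto
    qed
  qed
  also have "\<dots> = 2 * card M * ((n - 1) div 4)"
    using card_Union_matching(1)[OF Me] by simp
  finally have "2 * card (?G - ?F) \<le> card M * (4 * ((n - 1) div 4))" by simp
  also have "\<dots> \<le> card M * (n - 1)" by (intro mult_le_mono2) simp
  finally have 2: "2 * card (?G - ?F) \<le> card M * (n - 1)" .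
  have "?F \<subseteq> ?G" by auto
  then have "card (?G - ?F) = card ?G - card ?F" "card ?F \<le> card ?G"
    by (auto intro!: card_Diff_subset card_mono finite_subset[of ?F ?G])
  with 1 2 have "2 * card ?G \<le> 2 * (card ?A * (n - 1)) + card M * (n - 1)" by linarith
  then show ?thesis by (simp add: algebra_simps)
qed

context
  fixes E :: "nat \<Rightarrow> nat \<Rightarrow> bool" and n q :: nat and M :: "nat set set"
  assumes sym: "\<And>u v. E u v \<Longrightarrow> E v u" and irr: "\<And>v. \<not> E v v"
    and M: "matching (light_adj E n) n M"
    and max: "\<forall>M'. matching (light_adj E n) n M' \<longrightarrow> card M' \<le> card M" and q: "q = card M"
begin

text \<open>A rank above \<open>q\<close> would give \<open>q + 1\<close> non-heavy vertices of
  light degree at least \<open>2 * (q + 1)\<close>, and greedy matching from scratch would beat the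
  maximum \<open>q\<close>.\<close>

lemma degree_rank_le:
  assumes "2 * q + 2 \<le> light_degree E n v"
  shows "degree_rank E n v \<le> q"
proof (rule ccontr)
  let ?U = "{u. u < n \<and> \<not> heavy E n u \<and> light_degree E n v \<le> light_degree E n u}"
  assume "\<not> ?thesis"
  then have "q + 1 \<le> card ?U" by (simp add: degree_rank_def)
  then obtain W where W: "W \<subseteq> ?U" "card W = q + 1"
    by (meson obtain_subset_with_card_n)
  have "\<exists>M'. matching (light_adj E n) n M' \<and> card M' = card ({} :: nat set set) + card W"
  proof (rule greedy_matching)
    show "matching (light_adj E n) n {}" by (simp add: matching_def)
    fix v' assume "v' \<in> W"
    with W(1) have "\<not> heavy E n v'" "light_degree E n v \<le> light_degree E n v'" by auto
    with assms W(2) show "2 * (card ({} :: nat set set) + card W) \<le> card {u. u < n \<and> light_adj E n v' u}"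
      by (simp add: light_nbrs light_degree_def)
  qed (use W irr in \<open>auto simp: light_adj_def\<close>)
  with max W(2) q show False by fastforce
qed

text \<open>Consider the medium vertex of least light degree. All of \<open>B\<close> counts towards
  its rank, so its threshold bounds \<open>card B\<close>, and every other medium vertex has at
  least its light degree.\<close>

lemma medium_bounds:
  defines "B \<equiv> {v. v < n \<and> medium E n v}"
  shows "card B \<le> q" and "v \<in> B \<Longrightarrow> 3 * card B \<le> light_degree E n v + 1"
proof -
  have "card B \<le> q \<and> (\<forall>v\<in>B. 3 * card B \<le> light_degree E n v + 1)"
  proof (cases "B = {}")
    case False
    then obtain v where v: "v \<in> B" "\<And>u. u \<in> B \<Longrightarrow> light_degree E n v \<le> light_degree E n u"
      using ex_has_least_nat[of "\<lambda>v. v \<in> B" _ "light_degree E n"] by blast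
    have "B \<subseteq> {u. u < n \<and> \<not> heavy E n u \<and> light_degree E n v \<le> light_degree E n u}"
      using v(2) by (auto simp: B_def medium_def)
    then have r: "card B \<le> degree_rank E n v"
      unfolding degree_rank_def by (intro card_mono) auto
    have d: "3 * degree_rank E n v \<le> light_degree E n v + 1"
      using v(1) by (simp add: B_def medium_def)
    have "degree_rank E n v \<le> q"
    proof (cases "2 * q + 2 \<le> light_degree E n v")
      case True then show ?thesis by (rule degree_rank_le)
    next
      \<comment> \<open>The light degree is at most \<open>2 * q + 1\<close>, so three times the
        rank is at most \<open>2 * q + 2\<close>; for integers this forces rank at most
        \<open>q\<close>, including \<open>q = 0\<close> and \<open>q = 1\<close>.\<close>
      case False then show ?thesis using d by linarith
    qed
    moreover have "3 * card B \<le> light_degree E n u + 1" if "u \<in> B" for u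
      using v(2)[OF that] d r by linarith
    ultimately show ?thesis using r by auto
  qed simp
  then show "card B \<le> q" "v \<in> B \<Longrightarrow> 3 * card B \<le> light_degree E n v + 1" by auto
qed

text \<open>By maximality each small edge meets \<open>\<Union>M\<close>, and does so in a
  non-medium vertex. Such a vertex has light degree below \<open>2 * q + 2\<close>, or else rank at
  most \<open>q\<close> and then, failing the medium test, light degree below
  \<open>3 * q\<close>.\<close>

lemma card_small_edges_le: "card (small_edges E n) \<le> 2 * q * (3 * q + 1)"
proof -
  let ?S = "{v \<in> \<Union>M. \<not> medium E n v}"
  have Me: "M \<subseteq> edges n" "\<forall>e\<in>M. \<forall>f\<in>M. e \<noteq> f \<longrightarrow> e \<inter> f = {}"
    using M graph_edges_subset unfolding matching_def by blast+
  have fin: "finite (\<Union>M)" using card_Union_matching(3)[OF Me] .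
  have "card (small_edges E n) \<le> card ?S * (3 * q + 1)"
  proof (rule edges_covered_card[of _ "light_adj E n"])
    show "finite ?S" using fin by (rule rev_finite_subset) auto
    show "light_adj E n v u" if "light_adj E n u v" for u v
      using that sym by (auto simp: light_adj_def)
    show G: "small_edges E n \<subseteq> graph_edges (light_adj E n) n"
      unfolding small_edges_def graph_edges_def light_adj_def by blast
    show "e \<inter> ?S \<noteq> {}" if "e \<in> small_edges E n" for e
      using maximum_matching_covers[OF M max, of e] that G by (auto simp: small_edges_def)
    show "card {u. u < n \<and> light_adj E n v u} \<le> 3 * q + 1" if "v \<in> ?S" for v
    proof -
      have h: "\<not> heavy E n v"
        using that M unfolding matching_def graph_edges_def light_adj_def by blast
      with that have "light_degree E n v + 1 < 3 * degree_rank E n v"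
        by (auto simp: medium_def)
      with degree_rank_le[of v] have "light_degree E n v \<le> 3 * q + 1" by linarith
      then show ?thesis using h by (simp add: light_nbrs light_degree_def)
    qed
  qed
  also have "\<dots> \<le> card (\<Union>M) * (3 * q + 1)"
    using fin by (intro mult_le_mono1 card_mono) auto
  also have "card (\<Union>M) = 2 * q" using card_Union_matching(1)[OF Me] q by simp
  finally show ?thesis .
qed

text \<open>With \<open>b\<close> medium vertices the light degree is at least
  \<open>3 b - 1\<close>, and at most \<open>b - 1\<close> of these neighbours are medium. This is
  why \<open>medium\<close> has its \<open>+ 1\<close> and its factor 3.\<close>

lemma small_nbrs_medium:
  assumes "v < n" "medium E n v"
  shows "2 * card {v. v < n \<and> medium E n v} \<le> card (small_nbrs E n v)"
proof -
  let ?B = "{v. v < n \<and> medium E n v}"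
  have "{u. u < n \<and> \<not> heavy E n u \<and> E v u} \<subseteq> small_nbrs E n v \<union> (?B - {v})"
    using irr by (auto simp: small_nbrs_def)
  then have "light_degree E n v \<le> card (small_nbrs E n v \<union> (?B - {v}))"
    unfolding light_degree_def by (intro card_mono) (auto simp: small_nbrs_def)
  also have "\<dots> \<le> card (small_nbrs E n v) + card (?B - {v})" by (rule card_Un_le)
  also have "card (?B - {v}) = card ?B - 1" using assms by simp
  finally have "light_degree E n v \<le> card (small_nbrs E n v) + (card ?B - 1)" .
  moreover have "3 * card ?B \<le> light_degree E n v + 1" using medium_bounds(2)[of v] assms by simp
  moreover have "card {v} \<le> card ?B" using assms by (intro card_mono) auto
  ultimately show ?thesis by simp
qed

end

text \<open>The degree is at least \<open>n / 4 - 1\<close>, hence at least three times the number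
  of heavy and medium vertices minus 1; excluding those other than \<open>v\<close> leaves two
  thirds.\<close>

lemma small_nbrs_heavy:
  assumes "\<And>v. \<not> E v v" "v < n" "heavy E n v"
    and "12 * (card {v. v < n \<and> heavy E n v} + card {v. v < n \<and> medium E n v}) \<le> n"
  shows "2 * (card {v. v < n \<and> heavy E n v} + card {v. v < n \<and> medium E n v}) \<le> card (small_nbrs E n v)"
proof -
  let ?A = "{v. v < n \<and> heavy E n v}" and ?B = "{v. v < n \<and> medium E n v}"
  have "{u. u < n \<and> E v u} \<subseteq> small_nbrs E n v \<union> ((?A - {v}) \<union> ?B)"
    using assms(1) by (auto simp: small_nbrs_def)
  then have "card {u. u < n \<and> E v u} \<le> card (small_nbrs E n v \<union> ((?A - {v}) \<union> ?B))"
    by (intro card_mono) (auto simp: small_nbrs_def)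
  also have "\<dots> \<le> card (small_nbrs E n v) + (card (?A - {v}) + card ?B)"
    by (meson add_left_mono card_Un_le le_trans)
  also have "card (?A - {v}) = card ?A - 1" using assms by simp
  finally have "card {u. u < n \<and> E v u} \<le> card (small_nbrs E n v) + (card ?A - 1 + card ?B)" .
  moreover have "card {v} \<le> card ?A" using assms by (intro card_mono) auto
  ultimately show ?thesis using assms(3,4) unfolding heavy_def by simp
qed

section \<open>Hamilton cycles\<close>

definition cycle_edge :: "nat list \<Rightarrow> nat \<Rightarrow> nat set" where
  "cycle_edge vs i = {vs ! i, vs ! ((i + 1) mod length vs)}"

lemma cycle_edges_image: "cycle_edges vs = cycle_edge vs ` {..<length vs}"
  unfolding cycle_edges_def cycle_edge_def by auto

lemma vertex_order_length: "is_vertex_order n vs \<Longrightarrow> length vs = n"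
  unfolding is_vertex_order_def using distinct_card[of vs] by simp

lemma next_mod: "i < n \<Longrightarrow> (i + 1) mod n = (if i + 1 = n then 0 else i + 1)" for n :: nat
  by auto

text \<open>If two positions gave the same edge, each would be the cyclic successor of the other,
  which needs \<open>n = 2\<close>.\<close>

lemma cycle_edge_inj:
  assumes "is_vertex_order n vs" "n \<ge> 3"
  shows "inj_on (cycle_edge vs) {..<n}"
proof (rule inj_onI)
  fix i j assume ij: "i \<in> {..<n}" "j \<in> {..<n}" and eq: "cycle_edge vs i = cycle_edge vs j"
  have len: "length vs = n" and dist: "distinct vs"
    using assms vertex_order_length by (auto simp: is_vertex_order_def)
  have nth: "vs ! a = vs ! b \<longleftrightarrow> a = b" if "a < n" "b < n" for a b
    using nth_eq_iff_index_eq[OF dist] len that by simp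
  have "(i + 1) mod n < n" "(j + 1) mod n < n"
    using assms by simp_all
  with eq ij have "i = j \<or> (i = (j + 1) mod n \<and> j = (i + 1) mod n)"
    unfolding cycle_edge_def len by (auto simp: doubleton_eq_iff nth)
  then show "i = j"
    using ij assms(2) next_mod[of i n] next_mod[of j n] by (auto split: if_splits)
qed

lemma card_ham_cycle:
  assumes "H \<in> ham_cycles n" "n \<ge> 3"
  shows "card H = n"
proof -
  obtain vs where vs: "H = cycle_edges vs" "is_vertex_order n vs"
    using assms by (auto simp: ham_cycles_def)
  then show ?thesis
    using card_image[OF cycle_edge_inj[OF vs(2) assms(2)]] vertex_order_length[OF vs(2)]
    by (simp add: cycle_edges_image)
qed

lemma ham_cycle_subset:
  assumes "H \<in> ham_cycles n" "n \<ge> 2"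
  shows "H \<subseteq> edges n"
proof
  fix e assume "e \<in> H"
  obtain vs where vs: "H = cycle_edges vs" "is_vertex_order n vs"
    using assms by (auto simp: ham_cycles_def)
  have len: "length vs = n" using vertex_order_length[OF vs(2)] .
  obtain i where i: "i < n" "e = {vs ! i, vs ! ((i + 1) mod n)}"
    using \<open>e \<in> H\<close> vs(1) len by (auto simp: cycle_edges_def)
  have l: "(i + 1) mod n < n" using assms by simp
  have "i \<noteq> (i + 1) mod n" using i(1) assms(2) next_mod[of i n] by auto
  then have "vs ! i \<noteq> vs ! ((i + 1) mod n)"
    using vs(2) nth_eq_iff_index_eq[of vs i "(i + 1) mod n"] i(1) l len by (auto simp: is_vertex_order_def)
  moreover have "vs ! i \<in> set vs" "vs ! ((i + 1) mod n) \<in> set vs"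
    using i(1) l len by auto
  then have "vs ! i < n" "vs ! ((i + 1) mod n) < n"
    using vs(2) by (auto simp: is_vertex_order_def)
  ultimately show "e \<in> edges n"
    using i(2) by (auto simp: edges_def)
qed

lemma finite_ham_cycles:
  assumes "n \<ge> 2"
  shows "finite (ham_cycles n)" "H \<in> ham_cycles n \<Longrightarrow> finite H"
proof -
  have "ham_cycles n \<subseteq> Pow (edges n)" using ham_cycle_subset assms by blast
  then show "finite (ham_cycles n)"
    by (rule finite_subset) simp
  show "finite H" if "H \<in> ham_cycles n"
    using ham_cycle_subset[OF that assms] by (rule finite_subset) simp
qed

lemma ham_cycle_degree:
  assumes "H \<in> ham_cycles n" "n \<ge> 3"
  shows "card {e \<in> H. v \<in> e} \<le> 2"
proof -
  obtain vs where vs: "H = cycle_edges vs" "is_vertex_order n vs"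
    using assms by (auto simp: ham_cycles_def)
  have len: "length vs = n" and dist: "distinct vs"
    using vs(2) vertex_order_length by (auto simp: is_vertex_order_def)
  show ?thesis
  proof (cases "v \<in> set vs")
    case True
    then obtain j where j: "j < n" "v = vs ! j"
      using len by (auto simp: in_set_conv_nth)
    define k where "k = (if j = 0 then n - 1 else j - 1)"
    have "{e \<in> H. v \<in> e} \<subseteq> {cycle_edge vs j, cycle_edge vs k}"
    proof
      fix e assume e: "e \<in> {e \<in> H. v \<in> e}"
      then obtain i where i: "i < n" "e = cycle_edge vs i"
        using vs(1) len by (auto simp: cycle_edges_image)
      have l: "(i + 1) mod n < n" using assms by simp
      have "vs ! j = vs ! i \<or> vs ! j = vs ! ((i + 1) mod n)"
        using e i(2) j(2) len by (auto simp: cycle_edge_def)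
      then have "j = i \<or> j = (i + 1) mod n"
        using nth_eq_iff_index_eq[OF dist, of j i] nth_eq_iff_index_eq[OF dist, of j "(i + 1) mod n"] i(1) j(1) l len by auto
      then have "i = j \<or> i = k"
        using i(1) j(1) next_mod[of i n] by (auto simp: k_def split: if_splits)
      then show "e \<in> {cycle_edge vs j, cycle_edge vs k}" using i(2) by auto
    qed
    then have "card {e \<in> H. v \<in> e} \<le> card {cycle_edge vs j, cycle_edge vs k}"
      by (intro card_mono) auto
    also have "\<dots> \<le> 2" by (simp add: card_insert_if)
    finally show ?thesis .
  next
    case False
    have "e \<subseteq> set vs" if "e \<in> H" for e
      using ham_cycle_subset[OF assms(1)] assms(2) that vs(2) by (force simp: edges_eq is_vertex_order_def)
    then have "{e \<in> H. v \<in> e} = {}" using False by blast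
    then show ?thesis by (metis card.empty zero_le)
  qed
qed

lemma cycle_edges_map:
  "vs \<noteq> [] \<Longrightarrow> cycle_edges (map p vs) = (`) p ` cycle_edges vs"
  unfolding cycle_edges_image by (auto simp: cycle_edge_def image_iff)

lemma ham_cycle_permute:
  assumes "bij_betw p {0..<n} {0..<n}" "H \<in> ham_cycles n" "n \<ge> 1"
  shows "(`) p ` H \<in> ham_cycles n"
proof -
  obtain vs where vs: "H = cycle_edges vs" "is_vertex_order n vs"
    using assms by (auto simp: ham_cycles_def)
  have "is_vertex_order n (map p vs)"
    using vs(2) assms(1) by (auto simp: is_vertex_order_def distinct_map bij_betw_def)
  moreover have "vs \<noteq> []" using vertex_order_length[OF vs(2)] assms(3) by auto
  ultimately show ?thesis
    using vs(1) cycle_edges_map[of vs p] by (auto simp: ham_cycles_def)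
qed

text \<open>A permutation of the vertices carrying \<open>e\<close> to \<open>e'\<close> maps
  Hamilton cycles injectively to Hamilton cycles.\<close>

lemma ham_cycles_through_edge_le:
  assumes "e \<in> edges n" "e' \<in> edges n" "n \<ge> 2"
  shows "card {H \<in> ham_cycles n. e \<in> H} \<le> card {H \<in> ham_cycles n. e' \<in> H}"
proof -
  let ?V = "{0..<n}"
  have e: "e \<subseteq> ?V" "e' \<subseteq> ?V" "card e = 2" "card e' = 2" "finite e" "finite e'"
    using assms(1,2) by (auto simp: edges_eq atLeast0LessThan intro: finite_subset)
  obtain h where h: "bij_betw h e e'"
    using finite_same_card_bij[of e e'] e by auto
  obtain g where g: "bij_betw g (?V - e) (?V - e')"
    using finite_same_card_bij[of "?V - e" "?V - e'"] e by (auto simp: card_Diff_subset)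
  define p where "p x = (if x \<in> e then h x else g x)" for x
  have 1: "bij_betw p e e'"
    using h by (rule bij_betw_cong[THEN iffD1, rotated]) (simp add: p_def)
  have "bij_betw p (?V - e) (?V - e')"
    using g by (rule bij_betw_cong[THEN iffD1, rotated]) (auto simp: p_def)
  from bij_betw_combine[OF 1 this] have p: "bij_betw p ?V ?V"
    using e by (simp add: Un_absorb1)
  have "inj_on ((`) p) (Pow ?V)"
    using p by (simp add: bij_betw_def inj_on_image_Pow)
  then have "inj_on ((`) ((`) p)) (Pow (Pow ?V))"
    by (rule inj_on_image_Pow)
  moreover have "{H \<in> ham_cycles n. e \<in> H} \<subseteq> Pow (Pow ?V)"
    using ham_cycle_subset[OF _ assms(3)] by (auto simp: edges_eq atLeast0LessThan)
  ultimately have inj: "inj_on ((`) ((`) p)) {H \<in> ham_cycles n. e \<in> H}"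
    by (rule inj_on_subset)
  have "p ` e = e'" using 1 by (simp add: bij_betw_def)
  then have "((`) ((`) p)) ` {H \<in> ham_cycles n. e \<in> H} \<subseteq> {H \<in> ham_cycles n. e' \<in> H}"
    using ham_cycle_permute[OF p] assms(3) by auto
  then show ?thesis
    using card_inj_on_le[OF inj] finite_ham_cycles(1)[OF assms(3)] by simp
qed

lemma double_choose_two: "2 * (n choose 2) = n * (n - 1)"
proof -
  have "even (n * (n - 1))" by (cases n) auto
  then show ?thesis by (simp add: choose_two)
qed

text \<open>Double counting of incidences: each cycle uses \<open>n\<close> of the
  \<open>n choose 2\<close> edges, and by symmetry no edge is favoured, so the probability is at
  most \<open>2 / (n - 1)\<close>.\<close>

lemma ham_cycles_through_edge:
  assumes "e \<in> edges n" "n \<ge> 3"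
  shows "card {H \<in> ham_cycles n. e \<in> H} * (n - 1) \<le> 2 * card (ham_cycles n)"
proof -
  let ?X = "card {H \<in> ham_cycles n. e \<in> H}" and ?S = "ham_cycles n"
  have fin: "finite ?S" using finite_ham_cycles assms by simp
  have "?X * card (edges n) = (\<Sum>f\<in>edges n. ?X)" by simp
  also have "\<dots> \<le> (\<Sum>f\<in>edges n. card {H \<in> ?S. f \<in> H})"
    using ham_cycles_through_edge_le[OF assms(1)] assms(2) by (intro sum_mono) auto
  also have "\<dots> = (\<Sum>H\<in>?S. card {f \<in> edges n. f \<in> H})"
    unfolding card_eq_sum sum.inter_filter[OF fin] sum.inter_filter[OF finite_edges] by (rule sum.swap)
  also have "\<dots> = (\<Sum>H\<in>?S. n)"
  proof (rule sum.cong)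
    fix H assume H: "H \<in> ?S"
    have "{f \<in> edges n. f \<in> H} = H" using ham_cycle_subset[OF H] assms(2) by auto
    then show "card {f \<in> edges n. f \<in> H} = n" using card_ham_cycle[OF H assms(2)] by simp
  qed simp
  finally have "?X * (n choose 2) \<le> card ?S * n" by (simp add: card_edges)
  then have "2 * (?X * (n choose 2)) \<le> 2 * (card ?S * n)" by simp
  moreover note double_choose_two[of n]
  ultimately have "n * (?X * (n - 1)) \<le> n * (2 * card ?S)"
    by (metis mult.assoc mult.commute)
  then show ?thesis using assms(2) by simp
qed

lemma ham_cycles_meeting:
  assumes "F \<subseteq> edges n" "n \<ge> 3"
  shows "card {H \<in> ham_cycles n. H \<inter> F \<noteq> {}} * (n - 1) \<le> card F * (2 * card (ham_cycles n))"
proof -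
  have fF: "finite F" using assms(1) finite_subset finite_edges by blast
  have fin: "finite (ham_cycles n)" using finite_ham_cycles assms by simp
  have "card {H \<in> ham_cycles n. H \<inter> F \<noteq> {}} \<le> card (\<Union>e\<in>F. {H \<in> ham_cycles n. e \<in> H})"
    using fF fin by (intro card_mono) auto
  also have "\<dots> \<le> (\<Sum>e\<in>F. card {H \<in> ham_cycles n. e \<in> H})" by (rule card_UN_le[OF fF])
  finally have "card {H \<in> ham_cycles n. H \<inter> F \<noteq> {}} * (n - 1) \<le>
      (\<Sum>e\<in>F. card {H \<in> ham_cycles n. e \<in> H}) * (n - 1)" by simp
  also have "\<dots> = (\<Sum>e\<in>F. card {H \<in> ham_cycles n. e \<in> H} * (n - 1))"
    by (simp add: sum_distrib_right)
  also have "\<dots> \<le> (\<Sum>e\<in>F. 2 * card (ham_cycles n))"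
    using assms by (intro sum_mono ham_cycles_through_edge) auto
  finally show ?thesis by simp
qed

section \<open>Weight-zero edges of Hamilton cycles\<close>

lemma zero_edges_upper:
  assumes "H \<in> ham_cycles n" "n \<ge> 3" "H \<inter> small_edges E n = {}"
  shows "card (H \<inter> graph_edges E n) \<le>
    2 * (card {v. v < n \<and> heavy E n v} + card {v. v < n \<and> medium E n v})"
proof -
  let ?C = "{v. v < n \<and> heavy E n v} \<union> {v. v < n \<and> medium E n v}"
  have fH: "finite H" using finite_ham_cycles(2)[OF _ assms(1)] assms(2) by simp
  have "H \<inter> graph_edges E n \<subseteq> (\<Union>v\<in>?C. {e \<in> H. v \<in> e})"
  proof
    fix e assume e: "e \<in> H \<inter> graph_edges E n"
    then have "e \<notin> small_edges E n" using assms(3) by auto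
    then obtain v where v: "v \<in> e" "heavy E n v \<or> medium E n v" using e by (auto simp: small_edges_def)
    moreover have "v < n" using v(1) e by (auto simp: graph_edges_def)
    ultimately show "e \<in> (\<Union>v\<in>?C. {e \<in> H. v \<in> e})" using e by blast
  qed
  then have "card (H \<inter> graph_edges E n) \<le> card (\<Union>v\<in>?C. {e \<in> H. v \<in> e})"
    using fH by (intro card_mono) auto
  also have "\<dots> \<le> (\<Sum>v\<in>?C. card {e \<in> H. v \<in> e})" by (rule card_UN_le) simp
  also have "\<dots> \<le> (\<Sum>v\<in>?C. 2)" by (intro sum_mono ham_cycle_degree[OF assms(1,2)])
  also have "\<dots> = 2 * card ?C" by simp
  also have "\<dots> \<le> 2 * (card {v. v < n \<and> heavy E n v} + card {v. v < n \<and> medium E n v})"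
    by (intro mult_le_mono2 card_Un_le)
  finally show ?thesis .
qed

lemma chain_nth:
  assumes "t < length T" "T ! t = (x, v, y)"
  shows "chain T ! (3 * t) = x" "chain T ! (3 * t + 1) = v" "chain T ! (3 * t + 2) = y"
    "length (chain T) = 3 * length T"
proof -
  have len: "length (chain T) = 3 * length T" for T
    by (induction T) (auto simp: chain_def)
  have "chain T ! (3 * t) = x \<and> chain T ! (3 * t + 1) = v \<and> chain T ! (3 * t + 2) = y"
    using assms
  proof (induction T arbitrary: t)
    case (Cons a T)
    obtain x' v' y' where a: "a = (x', v', y')" by (cases a)
    have c: "chain (a # T) = x' # v' # y' # chain T" by (simp add: chain_def a)
    show ?case
    proof (cases t)
      case 0 then show ?thesis unfolding c using Cons.prems a by auto
    next
      case (Suc s)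
      then have "chain T ! (3 * s) = x \<and> chain T ! (3 * s + 1) = v \<and> chain T ! (3 * s + 2) = y"
        using Cons by simp
      moreover have "3 * t = Suc (Suc (Suc (3 * s)))" "3 * t + 1 = Suc (Suc (Suc (3 * s + 1)))"
        "3 * t + 2 = Suc (Suc (Suc (3 * s + 2)))" using Suc by auto
      ultimately show ?thesis unfolding c by (simp only: nth_Cons_Suc)
    qed
  qed simp
  with len show "chain T ! (3 * t) = x" "chain T ! (3 * t + 1) = v" "chain T ! (3 * t + 2) = y"
    "length (chain T) = 3 * length T" by auto
qed

text \<open>Triple number \<open>t\<close> sits at positions \<open>3 * t\<close> to
  \<open>3 * t + 2\<close>, so its two edges are cycle edges number \<open>3 * t\<close> and
  \<open>3 * t + 1\<close>. None wraps around, and injectivity of \<open>cycle_edge\<close> makes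
  them all different.\<close>

lemma zero_edges_lower:
  assumes "is_vertex_order n L" "n \<ge> 3" "L = chain T @ R" "cherries E n T"
    and sym: "\<And>u v. E u v \<Longrightarrow> E v u"
  shows "2 * length T \<le> card (cycle_edges L \<inter> graph_edges E n)"
proof (cases "T = []")
  case False
  let ?I = "(\<lambda>t. 3 * t) ` {..<length T} \<union> (\<lambda>t. 3 * t + 1) ` {..<length T}"
  have len: "length L = n" using vertex_order_length[OF assms(1)] .
  have dist: "distinct L" using assms(1) by (simp add: is_vertex_order_def)
  have lc: "length (chain T) = 3 * length T"
    using chain_nth(4)[of 0 T] False by (cases "T ! 0") auto
  then have le: "3 * length T \<le> n" using len assms(3) by auto
  have "(\<lambda>t. 3 * t) ` {..<length T} \<inter> (\<lambda>t. 3 * t + 1) ` {..<length T} = {}"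
    by (auto, presburger)
  then have "card ?I = card ((\<lambda>t::nat. 3 * t) ` {..<length T}) + card ((\<lambda>t::nat. 3 * t + 1) ` {..<length T})"
    by (intro card_Un_disjoint) auto
  also have "\<dots> = 2 * length T"
    by (subst (1 2) card_image) (auto simp: inj_on_def)
  finally have cI: "card ?I = 2 * length T" .
  have I: "?I \<subseteq> {..<n}" using le by auto
  have edge: "cycle_edge L (3 * t) \<in> graph_edges E n \<and> cycle_edge L (3 * t + 1) \<in> graph_edges E n"
    if t: "t < length T" for t
  proof -
    obtain x v y where T: "T ! t = (x, v, y)" by (cases "T ! t")
    then have "(x, v, y) \<in> set T" using t by (metis nth_mem)
    then have c: "x \<in> small_nbrs E n v" "y \<in> small_nbrs E n v" "heavy E n v \<or> medium E n v"
      using assms(4) by (auto simp: cherries_def)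
    have t3: "3 * t + 2 < 3 * length T" using t by linarith
    have nth: "L ! (3 * t) = x" "L ! (3 * t + 1) = v" "L ! (3 * t + 2) = y"
      using chain_nth(1-3)[OF t T] t3 lc by (simp_all add: assms(3) nth_append)
    have "3 * t + 1 < length L" using t3 le len by linarith
    then have "v \<in> set L" unfolding nth(2)[symmetric] by (rule nth_mem)
    then have v: "v < n" using assms(1) by (simp add: is_vertex_order_def)
    have m: "(3 * t + 1) mod n = 3 * t + 1" "(3 * t + 1 + 1) mod n = 3 * t + 2"
      using t3 le by simp_all
    have "cycle_edge L (3 * t) = {x, v}" "cycle_edge L (3 * t + 1) = {v, y}"
      unfolding cycle_edge_def len m nth by simp_all
    moreover have "{x, v} \<in> graph_edges E n" "{v, y} \<in> graph_edges E n"
      using c v sym unfolding graph_edges_def small_nbrs_def by blast+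
    ultimately show ?thesis by simp
  qed
  have "cycle_edge L ` ?I \<subseteq> cycle_edges L \<inter> graph_edges E n"
    using edge I unfolding cycle_edges_image len by blast
  then have "card (cycle_edge L ` ?I) \<le> card (cycle_edges L \<inter> graph_edges E n)"
    by (intro card_mono) auto
  moreover have "card (cycle_edge L ` ?I) = card ?I"
    by (rule card_image[OF inj_on_subset[OF cycle_edge_inj[OF assms(1,2)] I]])
  ultimately show ?thesis using cI by simp
qed simp

section \<open>Dense instances\<close>

text \<open>As Hamilton cycles all have \<open>n\<close> edges, comparing weights becomes comparing
  numbers of weight-zero edges.\<close>

lemma weight_eq:
  assumes "zero_one_instance n w" "H \<subseteq> edges n"
  shows "weight w H = real (card H) - real (card (H \<inter> {e \<in> edges n. w e = 0}))"
proof -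
  let ?Z = "{e \<in> edges n. w e = 0}"
  have fin: "finite H" using assms(2) finite_subset finite_edges by blast
  have "weight w H = (\<Sum>e\<in>H. 1 - (if e \<in> ?Z then 1 else 0))"
    unfolding weight_def using assms by (intro sum.cong) (auto simp: zero_one_instance_def)
  also have "\<dots> = real (card H) - (\<Sum>e\<in>H. if e \<in> ?Z then 1 else 0)"
    by (simp add: sum_subtractf)
  also have "(\<Sum>e\<in>H. if e \<in> ?Z then 1 else 0) = real (card (H \<inter> ?Z))"
    unfolding sum.inter_restrict[OF fin, symmetric] by simp
  finally show ?thesis .
qed

text \<open>An optimal matching containing \<open>M\<close> has weight at most
  \<open>n / 2 - card M\<close>, while density makes it at least
  \<open>d * n / 2 - r\<close>.\<close>

lemma dense_matching_bound:
  assumes "dense_instance n d r \<epsilon> w" "M \<subseteq> {e \<in> edges n. w e = 0}"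
    and "\<forall>e\<in>M. \<forall>f\<in>M. e \<noteq> f \<longrightarrow> e \<inter> f = {}"
  shows "real (card M) \<le> (1 - d) * real n / 2 + r"
proof -
  let ?Z = "{e \<in> edges n. w e = 0}"
  have zo: "zero_one_instance n w" and opt: "\<And>M. optimal_matching n M \<Longrightarrow> weight w M \<ge> d * real n / 2 - r"
    using assms(1) unfolding dense_instance_def by blast+
  obtain M' where M': "M \<subseteq> M'" "optimal_matching n M'"
    using extend_to_optimal_matching[of M n] assms(2,3) by blast
  then have sub: "M' \<subseteq> edges n" and c: "card M' = n div 2" by (auto simp: optimal_matching_def)
  have fin: "finite M'" using sub finite_subset finite_edges by blast
  have "M \<subseteq> M' \<inter> ?Z" using M'(1) assms(2) by blast
  then have "card M \<le> card (M' \<inter> ?Z)" using fin by (intro card_mono) auto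
  moreover have "real (n div 2) \<le> real n / 2" by linarith
  moreover have "(1 - d) * real n / 2 = real n / 2 - d * real n / 2" by (simp add: field_simps)
  ultimately show ?thesis
    using opt[OF M'(2)] weight_eq[OF zo sub] c by linarith
qed

lemma dense_card_zero_edges:
  assumes "dense_instance n d r \<epsilon> w"
  shows "2 * real (card {e \<in> edges n. w e = 0}) = (1 - d) * real n * real (n - 1)"
proof -
  let ?Z = "{e \<in> edges n. w e = 0}"
  have "zero_one_instance n w" "weight w (edges n) = d * real (n choose 2)"
    using assms unfolding dense_instance_def by blast+
  moreover have "edges n \<inter> ?Z = ?Z" by blast
  ultimately have "real (card ?Z) = (1 - d) * real (n choose 2)"
    using weight_eq[of n w "edges n"] by (simp add: card_edges algebra_simps)
  moreover have "2 * real (n choose 2) = real n * real (n - 1)"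
    using double_choose_two[of n] by (metis of_nat_mult of_nat_numeral)
  ultimately show ?thesis by (metis mult.assoc mult.left_commute)
qed

lemma dense_structure:
  assumes dense: "dense_instance n d r \<epsilon> w" and n: "n \<ge> 23" and s: "46 * r \<le> s" "s\<^sup>2 \<le> real n / 6"
    and E: "graph_edges E n = {e \<in> edges n. w e = 0}" and sym: "\<And>u v. E u v \<Longrightarrow> E v u"
    and irr: "\<And>v. \<not> E v v"
  defines "a \<equiv> card {v. v < n \<and> heavy E n v}" and "b \<equiv> card {v. v < n \<and> medium E n v}"
  shows "\<exists>q. real q \<le> 2 * r \<and> card (small_edges E n) \<le> 2 * q * (3 * q + 1)"
    and "\<forall>v<n. medium E n v \<longrightarrow> 2 * b \<le> card (small_nbrs E n v)"
    and "\<forall>v<n. heavy E n v \<longrightarrow> 2 * (a + b) \<le> card (small_nbrs E n v)"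
proof -
  define X where "X = (1 - d) * real n / 2 + r"
  define k where "k = nat \<lfloor>X\<rfloor>"
  have d: "0 \<le> 1 - d" "1 - d \<le> 1 / 12" and r: "r > 0"
    using dense by (auto simp: dense_instance_def)
  have "(1 - d) * real n \<le> 1 / 12 * real n" using d by (intro mult_right_mono) auto
  then have X: "0 \<le> X" "X \<le> real n / 24 + r"
    unfolding X_def using d r by (simp, linarith)
  have kX: "real k \<le> X" using X(1) by (simp add: k_def)
  \<comment> \<open>Turns the quadratic bound on \<open>s\<close> into a linear one, so that
    \<open>r\<close> is at most \<open>(n / 12 + 1 / 2) / 46\<close>.\<close>
  have "0 \<le> (s - 1)\<^sup>2" by simp
  then have "2 * s \<le> s\<^sup>2 + 1" by (simp add: power2_diff)
  then have sl: "s \<le> real n / 12 + 1 / 2" using s(2) by linarith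
  have km: "card M \<le> k" if "matching E n M" for M
  proof -
    have "real (card M) \<le> X"
      unfolding X_def using that by (intro dense_matching_bound[OF dense]) (auto simp: matching_def E)
    then show ?thesis unfolding k_def by (rule le_nat_floor)
  qed
  \<comment> \<open>A failure would give \<open>n \<le> 8 * k + 8\<close>, whereas
    \<open>8 * k\<close> is at most \<open>n / 3 + 8 * r\<close>, only slightly more than
    \<open>n / 3\<close>.\<close>
  have deg: "2 * k + 2 \<le> card {u. u < n \<and> E v u}" if "v < n" "heavy E n v" for v
  proof (rule ccontr)
    assume "\<not> ?thesis"
    then have "card {u. u < n \<and> E v u} + 1 \<le> 2 * k + 2" by simp
    moreover have "n \<le> 4 * (card {u. u < n \<and> E v u} + 1)" using that(2) by (simp add: heavy_def)
    ultimately have "n \<le> 8 * k + 8" by simp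
    then have "real n \<le> 8 * real k + 8" by linarith
    with kX X(2) sl s(1) n show False by linarith
  qed
  obtain M where M: "matching (light_adj E n) n M"
    "\<forall>M'. matching (light_adj E n) n M' \<longrightarrow> card M' \<le> card M"
    using maximum_matching[of "light_adj E n" n k] km matching_mono by blast
  define q where "q = card M"
  have aq: "a + q \<le> k"
    unfolding a_def q_def by (rule card_heavy_plus_matching[OF irr km deg M(1)])
  have "2 * card (graph_edges E n) \<le> (2 * a + q) * (n - 1)"
    unfolding a_def q_def by (rule double_card_graph_edges_le[OF sym irr M])
  then have "real (2 * card (graph_edges E n)) \<le> real ((2 * a + q) * (n - 1))"
    by (simp only: of_nat_le_iff)
  then have "(1 - d) * real n * real (n - 1) \<le> (2 * real a + real q) * real (n - 1)"
    using dense_card_zero_edges[OF dense] by (simp add: E)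
  then have "(1 - d) * real n \<le> 2 * real a + real q" using n by simp
  moreover have "real a + real q \<le> X" using aq kX by linarith
  \<comment> \<open>Twice the matching bound reads \<open>2 a + 2 q \<le> (1 - d) n + 2 r\<close>,
    and the edge count bounds \<open>(1 - d) n\<close> by \<open>2 a + q\<close>.\<close>
  ultimately have q: "real q \<le> 2 * r" by (simp add: X_def)
  have "card (small_edges E n) \<le> 2 * q * (3 * q + 1)"
    by (rule card_small_edges_le[OF sym irr M q_def])
  with q show "\<exists>q. real q \<le> 2 * r \<and> card (small_edges E n) \<le> 2 * q * (3 * q + 1)" by blast
  show "\<forall>v<n. medium E n v \<longrightarrow> 2 * b \<le> card (small_nbrs E n v)"
    unfolding b_def using small_nbrs_medium[OF sym irr M q_def] by blast
  have "b \<le> q" unfolding b_def by (rule medium_bounds(1)[OF sym irr M q_def])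
  then have "real (a + b) \<le> X" using aq kX by linarith
  moreover have "23 \<le> real n" using n by simp
  \<comment> \<open>\<open>12 * X\<close> is at most \<open>n / 2 + 12 * r\<close>, and
    \<open>12 * r\<close> is at most \<open>n / 46 + 6 / 46\<close>.\<close>
  ultimately have "12 * real (a + b) \<le> real n" using X(2) sl s(1) by argo
  then have "12 * (a + b) \<le> n" by linarith
  then show "\<forall>v<n. heavy E n v \<longrightarrow> 2 * (a + b) \<le> card (small_nbrs E n v)"
    unfolding a_def b_def using small_nbrs_heavy[of E, OF irr] by blast
qed

text \<open>\<open>E\<close> is identified with the weight-zero edges only from 23 vertices on,
  because below that the program has overwritten part of its input. \<open>cherry\<close> has the
  shape of the conditional clause of \<open>Main_correct\<close>, so the machine plays no part in
  this argument.\<close>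

theorem dense_domination:
  assumes dense: "dense_instance n d r \<epsilon> w" and L: "is_vertex_order n L"
    and E: "n \<ge> 23 \<Longrightarrow> graph_edges E n = {e \<in> edges n. w e = 0}" and sym: "\<And>u v. E u v \<Longrightarrow> E v u"
    and irr: "\<And>v. \<not> E v v"
    and cherry: "\<lbrakk>\<forall>v<n. medium E n v \<longrightarrow> 2 * card {v. v < n \<and> medium E n v} \<le> card (small_nbrs E n v);
      \<forall>v<n. heavy E n v \<longrightarrow> 2 * (card {v. v < n \<and> heavy E n v} + card {v. v < n \<and> medium E n v})
        \<le> card (small_nbrs E n v)\<rbrakk>
      \<Longrightarrow> \<exists>T R. L = chain T @ R \<and> cherries E n T \<and>
        length T = card {v. v < n \<and> heavy E n v} + card {v. v < n \<and> medium E n v}"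
  shows "domination_ratio_at_least n w (cycle_edges L) (1 - 6 * real n powr (- 2 * \<epsilon>))"
proof -
  let ?Z = "{e \<in> edges n. w e = 0}" and ?S = "ham_cycles n"
  define p where "p = real n powr (- 2 * \<epsilon>)"
  define s where "s = real n powr (1 / 2 - \<epsilon>)"
  define bad where "bad = {H \<in> ?S. weight w H < weight w (cycle_edges L)}"
  have n4: "n \<ge> 4" and zo: "zero_one_instance n w" and r: "r > 0" and d: "0 \<le> 1 - d" "1 - d \<le> 1 / 12"
    using dense by (auto simp: dense_instance_def)
  define z where "z = 6 * (1 - d)\<^sup>2 * (real n + 1)"
  have "0 \<le> z" by (simp add: z_def)
  then have "46 * r \<le> z + 46 * r + 3 * (1 - d)" using d(1) by simp
  also have "\<dots> \<le> s"
    using dense unfolding dense_instance_def s_def z_def by blast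
  finally have s46: "46 * r \<le> s" .
  have "s\<^sup>2 = real n powr ((1 / 2 - \<epsilon>) + (1 / 2 - \<epsilon>))"
    by (simp only: s_def power2_eq_square powr_add)
  also have "(1 / 2 - \<epsilon>) + (1 / 2 - \<epsilon>) = 1 + - 2 * \<epsilon>" by simp
  also have "real n powr (1 + - 2 * \<epsilon>) = real n * p" using n4 by (simp only: powr_add p_def) simp
  finally have s2: "s\<^sup>2 = real n * p" .
  have p0: "p \<ge> 0" by (simp add: p_def)
  have fS: "finite ?S" using finite_ham_cycles n4 by simp
  have LS: "cycle_edges L \<in> ?S" using L by (auto simp: ham_cycles_def)
  have wt: "weight w H = real n - real (card (H \<inter> ?Z))" if "H \<in> ?S" for H
    using weight_eq[OF zo ham_cycle_subset[OF that]] card_ham_cycle[OF that] n4 by simp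
  have "real (card bad) \<le> 6 * p * real (card ?S)"
  proof (cases "6 * p \<ge> 1 \<or> ?Z = {}")
    case True
    then show ?thesis
    proof
      assume "6 * p \<ge> 1"
      have "card bad \<le> card ?S" unfolding bad_def using fS by (intro card_mono) auto
      then have "real (card bad) \<le> 1 * real (card ?S)" by simp
      also have "\<dots> \<le> 6 * p * real (card ?S)" using \<open>6 * p \<ge> 1\<close> by (intro mult_right_mono) auto
      finally show ?thesis .
    next
      assume Z: "?Z = {}"
      have "bad = {}" unfolding bad_def using wt wt[OF LS] unfolding Z by auto
      then show ?thesis using p0 by simp
    qed
  next
    case False
    then obtain e where e: "e \<in> ?Z" by auto
    have "real n * p \<le> real n * (1 / 6)" using False by (intro mult_left_mono) auto
    then have s6: "s\<^sup>2 \<le> real n / 6" using s2 by simp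
    \<comment> \<open>With at most 22 vertices, \<open>s\<close> is below 2 and \<open>r\<close>
      below \<open>2 / 46\<close>. A single weight-zero edge is a matching of size 1, but the
      matching bound is less than \<open>22 / 24 + 2 / 46 < 1\<close>.\<close>
    have n23: "n \<ge> 23"
    proof (rule ccontr)
      assume "\<not> ?thesis"
      then have n: "real n \<le> 22" by linarith
      have "s\<^sup>2 < 2\<^sup>2" using s6 n by simp
      then have "s < 2" by (rule power2_less_imp_less) simp
      moreover have "real (card {e}) \<le> (1 - d) * real n / 2 + r"
        by (rule dense_matching_bound[OF dense]) (use e in auto)
      moreover have "(1 - d) * real n \<le> 1 / 12 * 22" using d n by (intro mult_mono) auto
      ultimately show False using s46 by simp
    qed
    note st = dense_structure[OF dense n23 s46 s6 E[OF n23] sym irr]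
    let ?m = "card {v. v < n \<and> heavy E n v} + card {v. v < n \<and> medium E n v}"
    obtain T R where T: "L = chain T @ R" "cherries E n T" "length T = ?m"
      using cherry[OF st(2,3)] by blast
    have low: "2 * ?m \<le> card (cycle_edges L \<inter> ?Z)"
      using zero_edges_lower[OF L _ T(1,2) sym] n4 T(3) E[OF n23] by simp
    \<comment> \<open>A cycle lighter than the output has more than \<open>2 * ?m\<close>
      weight-zero edges, more than the heavy and medium vertices can account for.\<close>
    have "bad \<subseteq> {H \<in> ?S. H \<inter> small_edges E n \<noteq> {}}"
    proof
      fix H assume "H \<in> bad"
      then have H: "H \<in> ?S" "weight w H < weight w (cycle_edges L)" by (auto simp: bad_def)
      then have "card (cycle_edges L \<inter> ?Z) < card (H \<inter> ?Z)" using wt[OF H(1)] wt[OF LS] by simp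
      then have "\<not> card (H \<inter> graph_edges E n) \<le> 2 * ?m" using low E[OF n23] by simp
      then show "H \<in> {H \<in> ?S. H \<inter> small_edges E n \<noteq> {}}"
        using zero_edges_upper[OF H(1), of E] n4 H(1) by auto
    qed
    then have "card bad \<le> card {H \<in> ?S. H \<inter> small_edges E n \<noteq> {}}"
      using fS by (intro card_mono) auto
    then have "card bad * (n - 1) \<le> card {H \<in> ?S. H \<inter> small_edges E n \<noteq> {}} * (n - 1)"
      by (rule mult_le_mono1)
    also have "\<dots> \<le> card (small_edges E n) * (2 * card ?S)"
      using graph_edges_subset n4 by (intro ham_cycles_meeting) (auto simp: small_edges_def)
    also from st(1) obtain q where q: "real q \<le> 2 * r" "card (small_edges E n) \<le> 2 * q * (3 * q + 1)"
      by blast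
    then have "card (small_edges E n) * (2 * card ?S) \<le> 2 * q * (3 * q + 1) * (2 * card ?S)"
      by (intro mult_le_mono1) auto
    finally have "real (card bad * (n - 1)) \<le> real (2 * q * (3 * q + 1) * (2 * card ?S))"
      by (simp only: of_nat_le_iff)
    also have "real (2 * q * (3 * q + 1) * (2 * card ?S)) = (4 * real q * (3 * real q + 1)) * real (card ?S)"
      by (simp add: algebra_simps)
    finally have "real (card bad) * real (n - 1) \<le> (4 * real q * (3 * real q + 1)) * real (card ?S)"
      unfolding of_nat_mult .
    also have "\<dots> \<le> (6 * p * real (n - 1)) * real (card ?S)"
    proof (rule mult_right_mono)
      \<comment> \<open>From here \<open>16 q^2 \<le> 64 r^2 \<le> (46 r)^2 \<le> s^2 = n p\<close>,
        and the factor 6 of the claim absorbs the passage from \<open>n\<close> to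
        \<open>n - 1\<close>.\<close>
      have "real q \<le> (real q)\<^sup>2" by (cases q) (simp_all add: power2_eq_square)
      then have "4 * real q * (3 * real q + 1) \<le> 16 * (real q)\<^sup>2" by (simp add: power2_eq_square algebra_simps)
      also have "(real q)\<^sup>2 \<le> (2 * r)\<^sup>2" using q(1) by (intro power_mono) auto
      also have "16 * (2 * r)\<^sup>2 = 64 * r\<^sup>2" by (simp add: power_mult_distrib)
      also have "64 * r\<^sup>2 \<le> (46 * r)\<^sup>2" by (simp add: power_mult_distrib)
      also have "\<dots> \<le> s\<^sup>2" using s46 r by (intro power_mono) auto
      also have "\<dots> = real n * p" by (rule s2)
      also have "\<dots> \<le> (6 * real (n - 1)) * p" using n4 p0 by (intro mult_right_mono) auto
      finally show "4 * real q * (3 * real q + 1) \<le> 6 * p * real (n - 1)" by (simp add: algebra_simps)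
    qed simp
    also have "\<dots> = (6 * p * real (card ?S)) * real (n - 1)" by simp
    finally show ?thesis using n4 by simp
  qed
  then show ?thesis
    unfolding domination_ratio_at_least_def bad_def p_def by simp
qed

section \<open>Reading the instance from the machine input, and the result\<close>

lemma edge_val_input:
  assumes "zero_one_instance n w" "n \<ge> 23" "u < n" "v < n" "u \<noteq> v"
  shows "adj (clamp (n * n + 24) (input_mem n w)) n u v \<longleftrightarrow> w {u, v} = 0"
proof -
  define x y where "x = max u v" and "y = min u v"
  have xy: "x < n" "y < n" "x \<ge> 1" "x \<noteq> y" "{x, y} = {u, v}"
    using assms by (auto simp: x_def y_def max_def min_def)
  have "n \<le> x * n" using xy(3) by simp
  have "x * n + n \<le> n * n" using xy(1) by (metis Suc_leI add.commute mult_Suc mult_le_mono1)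
  then have lt: "x * n + y < n * n" using xy(2) by linarith
  have dm: "(x * n + y) div n = x" "(x * n + y) mod n = y" using xy(2) by auto
  have "clamp (n * n + 24) (input_mem n w) (1 + x * n + y) = input_mem n w (1 + x * n + y)"
  proof -
    \<comment> \<open>The row \<open>x\<close> is at least 1, so the address is at least
      \<open>1 + n\<close>; this is where 23 vertices are needed.\<close>
    have "24 \<le> 1 + x * n + y \<and> 1 + x * n + y < n * n + 24"
      using \<open>n \<le> x * n\<close> assms(2) lt by linarith
    then show ?thesis unfolding clamp_def by (rule if_P)
  qed
  also have "\<dots> = (if w {u, v} = 1 then 1 else 0)"
    using lt dm xy(4,5) by (simp add: input_mem_def)
  finally have "edge_val (clamp (n * n + 24) (input_mem n w)) n u v = (if w {u, v} = 1 then 1 else 0)"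
    using assms(5) by (simp add: edge_val_def x_def y_def)
  moreover have "w {u, v} = 0 \<or> w {u, v} = 1"
    using assms by (auto simp: zero_one_instance_def edges_def)
  ultimately show ?thesis by (auto simp: adj_def)
qed

lemma graph_edges_input:
  assumes "zero_one_instance n w" "n \<ge> 23"
  shows "graph_edges (adj (clamp (n * n + 24) (input_mem n w)) n) n = {e \<in> edges n. w e = 0}"
  unfolding graph_edges_def edges_def using edge_val_input[OF assms] by auto

theorem theorem5p10:
  shows "\<exists>(P :: instr list) (C :: nat).
    \<forall>n w. n \<ge> 4 \<and> zero_one_instance n w \<longrightarrow>
      (\<exists>t \<le> C * n ^ 4.
         halted P (run P t (0, input_mem n w)) \<and>
         is_vertex_order n (output_list n (run P t (0, input_mem n w))) \<and>
         (\<forall>d r \<epsilon>. dense_instance n d r \<epsilon> w \<longrightarrow>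
            domination_ratio_at_least n w
              (cycle_edges (output_list n (run P t (0, input_mem n w))))
              (1 - 6 * real n powr (- 2 * \<epsilon>))))"
proof (rule exI[of _ "program Main"], rule exI[of _ 2000], intro allI impI)
  fix n :: nat and w :: "nat set \<Rightarrow> real"
  assume nw: "n \<ge> 4 \<and> zero_one_instance n w"
  let ?w = "clamp (n * n + 24) (input_mem n w)"
  let ?run = "\<lambda>t. run (program Main) t (0, input_mem n w)"
  obtain t f where t: "t \<le> cost n Main + 11 * n + 65" "halted (program Main) (?run t)"
    "output_list n (?run t) = map (snd (sem ?w n Main (f, \<lambda>k i. 0)) 5) [0..<n]"
    using program_correct[OF wf_Main, of n w] by (auto simp: Let_def)
  have "t \<le> 2000 * n ^ 4"
    using t(1) cost_Main[of n] nw by linarith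
  moreover have ord: "is_vertex_order n (output_list n (?run t))"
    unfolding t(3) is_vertex_order_def
    using Main_correct(1,2)[of ?w n f] by (auto simp: atLeast0LessThan)
  moreover have "domination_ratio_at_least n w (cycle_edges (output_list n (?run t)))
      (1 - 6 * real n powr (- 2 * \<epsilon>))" if dense: "dense_instance n d r \<epsilon> w" for d r \<epsilon>
  proof (rule dense_domination[OF dense ord, where E = "adj ?w n"])
    show "adj ?w n v u" if "adj ?w n u v" for u v
      using that by (auto simp: adj_def edge_val_def max.commute min.commute)
    show "\<not> adj ?w n v v" for v
      by (simp add: adj_def edge_val_def)
  qed (use nw graph_edges_input Main_correct(3)[of n ?w f] t(3) in auto)
  ultimately show "\<exists>t \<le> 2000 * n ^ 4.
         halted (program Main) (?run t) \<and> is_vertex_order n (output_list n (?run t)) \<and>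
         (\<forall>d r \<epsilon>. dense_instance n d r \<epsilon> w \<longrightarrow>
            domination_ratio_at_least n w (cycle_edges (output_list n (?run t)))
              (1 - 6 * real n powr (- 2 * \<epsilon>)))"
    using t(2) by blast
qed

end
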